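(* Let $F, D\in B^a(H_{\mathcal A})$ and suppose that $D\in\mathcal M\Phi_-(H_{\mathcal A})$ and that either $F\in\mathcal M\Phi_-(H_{\mathcal A})$ or there exist decompositions $$H_{\mathcal A} = M_1 \tilde\oplus N_1 \stackrel{F}{\longrightarrow} N_2^\perp \oplus N_2 = H_{\mathcal A}, \qquad H_{\mathcal A} = {N_1'}^\perp \oplus N_1' \stackrel{D}{\longrightarrow} M_2' \tilde\oplus N_2' = H_{\mathcal A}$$ with respect to which $F, D$ have the matrices $\begin{pmatrix} F_1 & 0\\ 0 & F_4\end{pmatrix}$, $\begin{pmatrix} D_1 & 0\\ 0 & D_4\end{pmatrix}$, respectively, where $F_1, D_1$ are isomorphisms, $N_2'$ is finitely generated, and there exists some $\iota\in B^a(N_2, N_1')$ such that $\iota$ is an isomorphism onto its image in $N_1'$. Then $\mathbf M_C^{\mathcal A} = \begin{pmatrix} F & C \\ 0 & D\end{pmatrix}\in\mathcal M\Phi_-(H_{\mathcal A}\oplus H_{\mathcal A})$ for some $C\in B^a(H_{\mathcal A})$.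
   Context: $\mathcal A$ is a unital $C^*$-algebra and $H_{\mathcal A} = \ell^2(\mathcal A)$ is the standard Hilbert $\mathcal A$-module. For Hilbert $\mathcal A$-modules $H,K$, $B^a(H,K)$ denotes the bounded adjointable $\mathcal A$-linear operators $H\to K$, and $B^a(H) = B^a(H,H)$. $\oplus$ is the orthogonal direct sum; $\tilde\oplus$ denotes a direct sum of closed submodules that need not be orthogonal. A Hilbert module is finitely generated if it equals the linear span (over $\mathbb C$ and $\mathcal A$) of a finite subset. An isomorphism is a bounded $\mathcal A$-linear bijection with bounded inverse. For a decomposition $H = M_1\tilde\oplus N_1 \stackrel{T}{\longrightarrow} M_2\tilde\oplus N_2 = H$ into closed submodules, saying $T$ has matrix $\begin{pmatrix} T_1 & 0\\ 0& T_4\end{pmatrix}$ means $T(M_1)\subseteq M_2$, $T(N_1)\subseteq N_2$, $T_1 = T|_{M_1}: M_1\to M_2$, $T_4 = T|_{N_1}:N_1\to N_2$. For $H = H_{\mathcal A}$ or $H_{\mathcal A}\oplus H_{\mathcal A}$, $T\in B^a(H)$ is lower semi-$\mathcal A$-Fredholm, $T\in\mathcal M\Phi_-(H)$, if there is such a decomposition with diagonal matrix, $T_1$ an isomorphism and $N_2$ finitely generated. *)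

theory Defs
  imports "HOL-Analysis.Analysis" "HOL-Library.Function_Algebras"
begin

text \<open>Unital \<open>C\<^sup>*\<close>-algebras, with the usual normalisation \<open>\<parallel>1\<parallel> = 1\<close> (so \<open>0 \<noteq> 1\<close>).\<close>

class cstar_algebra = real_normed_algebra_1 + banach +
  fixes scaleC :: "complex \<Rightarrow> 'a \<Rightarrow> 'a"  (infixr "*\<^sub>C" 75)
    and star :: "'a \<Rightarrow> 'a"
  assumes scaleR_scaleC: "r *\<^sub>R x = complex_of_real r *\<^sub>C x"
    and scaleC_add_right: "c *\<^sub>C (x + y) = c *\<^sub>C x + c *\<^sub>C y"
    and scaleC_add_left: "(c + d) *\<^sub>C x = c *\<^sub>C x + d *\<^sub>C x"
    and scaleC_scaleC: "c *\<^sub>C d *\<^sub>C x = (c * d) *\<^sub>C x"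
    and mult_scaleC_left: "(c *\<^sub>C x) * y = c *\<^sub>C (x * y)"
    and mult_scaleC_right: "x * (c *\<^sub>C y) = c *\<^sub>C (x * y)"
    and norm_scaleC: "norm (c *\<^sub>C x) = cmod c * norm x"
    and star_star: "star (star x) = x"
    and star_add: "star (x + y) = star x + star y"
    and star_scaleC: "star (c *\<^sub>C x) = cnj c *\<^sub>C star x"
    and star_mult: "star (x * y) = star y * star x"
    and norm_star_mult: "norm (star x * x) = (norm x)\<^sup>2"

text \<open>
  A (right) inner-product module over \<open>'a\<close>, given by its underlying set, the right action of the
  algebra and the algebra-valued inner product (linear in the second argument). The additive group
  structure is that of the ambient type. There is no separate complex scalar multiplication: the
  algebra is unital, so \<open>c \<in> \<complex>\<close> acts on the module as \<open>c *\<^sub>C 1\<close>.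
\<close>

record ('a, 'h) hmodule =
  carrier :: "'h set"
  act :: "'h \<Rightarrow> 'a \<Rightarrow> 'h"
  ip :: "'h \<Rightarrow> 'h \<Rightarrow> 'a"

definition hnorm :: "('a::cstar_algebra, 'h::ab_group_add) hmodule \<Rightarrow> 'h \<Rightarrow> real" where
  "hnorm H x = sqrt (norm (ip H x x))"

definition ell2 :: "('a::cstar_algebra, nat \<Rightarrow> 'a) hmodule" where
  "ell2 = \<lparr>carrier = {x. summable (\<lambda>k. star (x k) * x k)},
           act = (\<lambda>x a k. x k * a),
           ip = (\<lambda>x y. \<Sum>k. star (x k) * y k)\<rparr>"

definition hsum :: "('a::cstar_algebra, 'h::ab_group_add) hmodule
    \<Rightarrow> ('a, 'k::ab_group_add) hmodule \<Rightarrow> ('a, 'h \<times> 'k) hmodule"  (infixr "\<oplus>\<^sub>H" 65) where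
  "H \<oplus>\<^sub>H K = \<lparr>carrier = carrier H \<times> carrier K,
            act = (\<lambda>(x, y) a. (act H x a, act K y a)),
            ip = (\<lambda>(x, y) (x', y'). ip H x x' + ip K y y')\<rparr>"

definition submod :: "('a::cstar_algebra, 'h::ab_group_add) hmodule \<Rightarrow> 'h set
    \<Rightarrow> ('a, 'h) hmodule" where
  "submod H M = H\<lparr>carrier := M\<rparr>"

definition closed_submodule ::
    "('a::cstar_algebra, 'h::ab_group_add) hmodule \<Rightarrow> 'h set \<Rightarrow> bool" where
  "closed_submodule H M \<longleftrightarrow>
     M \<subseteq> carrier H \<and> 0 \<in> M \<and> (\<forall>x\<in>M. \<forall>y\<in>M. x + y \<in> M) \<and> (\<forall>x\<in>M. \<forall>a. act H x a \<in> M) \<and>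
     (\<forall>s x. (\<forall>n. s n \<in> M) \<and> x \<in> carrier H \<and> (\<lambda>n. hnorm H (s n - x)) \<longlonglongrightarrow> 0 \<longrightarrow> x \<in> M)"

definition direct_sum ::
    "('a::cstar_algebra, 'h::ab_group_add) hmodule \<Rightarrow> 'h set \<Rightarrow> 'h set \<Rightarrow> bool" where
  "direct_sum H M N \<longleftrightarrow> closed_submodule H M \<and> closed_submodule H N \<and>
     carrier H = {m + n | m n. m \<in> M \<and> n \<in> N} \<and> M \<inter> N = {0}"

definition orth_compl ::
    "('a::cstar_algebra, 'h::ab_group_add) hmodule \<Rightarrow> 'h set \<Rightarrow> 'h set" where
  "orth_compl H N = {x \<in> carrier H. \<forall>y\<in>N. ip H y x = 0}"

definition fin_gen :: "('a::cstar_algebra, 'h::ab_group_add) hmodule \<Rightarrow> bool" where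
  "fin_gen H \<longleftrightarrow> (\<exists>S. finite S \<and> S \<subseteq> carrier H \<and>
     carrier H = {\<Sum>s\<in>S. act H s (a s) | a. True})"

text \<open>Operators are functions on the ambient types; only their values on the carrier matter.\<close>

definition mod_linear :: "('a::cstar_algebra, 'h::ab_group_add) hmodule
    \<Rightarrow> ('a, 'k::ab_group_add) hmodule \<Rightarrow> ('h \<Rightarrow> 'k) \<Rightarrow> bool" where
  "mod_linear H K T \<longleftrightarrow> T ` carrier H \<subseteq> carrier K \<and>
     (\<forall>x\<in>carrier H. \<forall>y\<in>carrier H. T (x + y) = T x + T y) \<and>
     (\<forall>x\<in>carrier H. \<forall>a. T (act H x a) = act K (T x) a)"

definition mod_bounded :: "('a::cstar_algebra, 'h::ab_group_add) hmodule
    \<Rightarrow> ('a, 'k::ab_group_add) hmodule \<Rightarrow> ('h \<Rightarrow> 'k) \<Rightarrow> bool" where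
  "mod_bounded H K T \<longleftrightarrow> (\<exists>B. \<forall>x\<in>carrier H. hnorm K (T x) \<le> B * hnorm H x)"

definition adjointable :: "('a::cstar_algebra, 'h::ab_group_add) hmodule
    \<Rightarrow> ('a, 'k::ab_group_add) hmodule \<Rightarrow> ('h \<Rightarrow> 'k) \<Rightarrow> bool" where
  "adjointable H K T \<longleftrightarrow> (\<exists>S. S ` carrier K \<subseteq> carrier H \<and>
     (\<forall>x\<in>carrier H. \<forall>y\<in>carrier K. ip K (T x) y = ip H x (S y)))"

definition Ba :: "('a::cstar_algebra, 'h::ab_group_add) hmodule
    \<Rightarrow> ('a, 'k::ab_group_add) hmodule \<Rightarrow> ('h \<Rightarrow> 'k) set" where
  "Ba H K = {T. mod_linear H K T \<and> mod_bounded H K T \<and> adjointable H K T}"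

definition mod_iso :: "('a::cstar_algebra, 'h::ab_group_add) hmodule
    \<Rightarrow> ('a, 'k::ab_group_add) hmodule \<Rightarrow> ('h \<Rightarrow> 'k) \<Rightarrow> bool" where
  "mod_iso H K T \<longleftrightarrow> mod_linear H K T \<and> mod_bounded H K T \<and>
     bij_betw T (carrier H) (carrier K) \<and> mod_bounded K H (inv_into (carrier H) T)"

text \<open>
  \<open>T\<close> has a diagonal matrix with respect to the (not necessarily orthogonal) decompositions
  \<open>M\<^sub>1 + N\<^sub>1\<close> of its domain and \<open>M\<^sub>2 + N\<^sub>2\<close> of its codomain.
\<close>

definition diagonal_wrt :: "('a::cstar_algebra, 'h::ab_group_add) hmodule \<Rightarrow> ('h \<Rightarrow> 'h)
    \<Rightarrow> 'h set \<Rightarrow> 'h set \<Rightarrow> 'h set \<Rightarrow> 'h set \<Rightarrow> bool" where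
  "diagonal_wrt H T M1 N1 M2 N2 \<longleftrightarrow>
     direct_sum H M1 N1 \<and> direct_sum H M2 N2 \<and> T ` M1 \<subseteq> M2 \<and> T ` N1 \<subseteq> N2"

definition MPhi_minus :: "('a::cstar_algebra, 'h::ab_group_add) hmodule \<Rightarrow> ('h \<Rightarrow> 'h) set" where
  "MPhi_minus H = {T \<in> Ba H H. \<exists>M1 N1 M2 N2. diagonal_wrt H T M1 N1 M2 N2 \<and>
     mod_iso (submod H M1) (submod H M2) T \<and> fin_gen (submod H N2)}"

definition upper_triangular :: "('h::ab_group_add \<Rightarrow> 'h) \<Rightarrow> ('k::ab_group_add \<Rightarrow> 'h) \<Rightarrow> ('k \<Rightarrow> 'k)
    \<Rightarrow> 'h \<times> 'k \<Rightarrow> 'h \<times> 'k" where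
  "upper_triangular F C D = (\<lambda>(x, y). (F x + C y, D y))"

end

(*
Write C = S P, where P is the orthogonal projection of the second summand onto N1' and S is the
adjoint of the embedding iota of N2 into N1'. Since iota is bounded below, S iota is invertible, so C
maps iota(N2) isomorphically onto N2 and thereby repairs the defect of surjectivity of F; what is
left uncovered in the codomain is 0 x N2', which is finitely generated. If F is itself lower
semi-Fredholm, C = 0 does.

The invertibility of S iota, the Cauchy-Schwarz inequality and the fact that l^2(A) is a module at
all rest on the positivity of x* x in a C*-algebra. It is derived from square roots obtained by a
fixed point iteration, without spectral theory.
*)

theory Submission
  imports Defs
begin

section \<open>Positive elements of a \<open>C\<^sup>*\<close>-algebra\<close>

text \<open>\<open>F\<close> sends \<open>N1\<close> into \<open>N2\<close>, and \<open>D\<close>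
  may send the copy of \<open>N2\<close> inside \<open>N1'\<close> to nonzero elements of
  \<open>N2'\<close>; so the matrix does not respect products of the given summands. The remedy is
  to tilt two summands. In the domain, each n in \<open>N1\<close> is paired with elements s of
  \<open>N1'\<close> that cancel F n in the first row. In the codomain, the second coordinate is
  shifted by an element of \<open>N2'\<close> that depends on the first coordinate. Being bounded
  below does not make an operator surjective, so the norm estimate for \<open>\<iota>\<close> is
  first turned into an inequality between algebra-valued inner products. It bounds the positive
  operator S \<open>\<iota>\<close> from below in the order sense, and then a Neumann series
  applies. Spectra are replaced by one test: a self-adjoint \<open>a\<close> is positive iff
  \<open>norm (of_real t - a) \<le> t\<close> for some t. Sums and limits of positive elements then
  reduce to norm estimates. The test says nothing direct about \<open>star x * x\<close>, which
  takes a separate argument.\<close>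

lemma star_0 [simp]: "star (0::'a::cstar_algebra) = 0"
  using star_add[of "0::'a" 0] by simp

lemma star_minus [simp]: "star (- x) = - star (x::'a::cstar_algebra)"
  using star_add[of x "- x"] by (simp add: minus_unique)

lemma star_diff: "star (x - y) = star x - star (y::'a::cstar_algebra)"
  using star_add[of x "- y"] by simp

lemma star_1 [simp]: "star (1::'a::cstar_algebra) = 1"
proof -
  have "star (star 1 * (1::'a)) = star 1 * star (star 1)" by (rule star_mult)
  then have "1 = star (1::'a)" by (simp only: star_star mult_1_right)
  then show ?thesis by simp
qed

lemma star_scaleR: "star (r *\<^sub>R x) = r *\<^sub>R star (x::'a::cstar_algebra)"
  by (simp add: scaleR_scaleC star_scaleC)

lemma star_of_real [simp]: "star (of_real r) = (of_real r :: 'a::cstar_algebra)"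
  by (simp add: of_real_def star_scaleR)

lemma star_sum: "star (sum f I) = (\<Sum>i\<in>I. star (f i :: 'a::cstar_algebra))"
  by (induction I rule: infinite_finite_induct) (auto simp: star_add)

lemma star_power: "star (x ^ n) = star (x::'a::cstar_algebra) ^ n"
  by (induction n) (auto simp: star_mult power_commutes)

text \<open>Cancelling norm y in \<open>norm (star y * y) \<le> norm (star y) * norm y\<close> gives
  one inequality for every y; the other is the same inequality at \<open>star x\<close>.\<close>

lemma norm_star [simp]: "norm (star x) = norm (x::'a::cstar_algebra)"
proof -
  have le: "norm y \<le> norm (star y)" for y :: 'a
  proof (cases "y = 0")
    case False
    have "norm y * norm y \<le> norm (star y) * norm y"
      by (metis norm_star_mult power2_eq_square norm_mult_ineq)
    then show ?thesis using False by simp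
  qed simp
  show ?thesis using le[of x] le[of "star x"] by (simp add: star_star)
qed

lemma norm_selfadjoint_square: "star h = h \<Longrightarrow> norm (h * h) = (norm (h::'a::cstar_algebra))\<^sup>2"
  by (metis norm_star_mult)

lemma bounded_linear_star: "bounded_linear (star :: 'a::cstar_algebra \<Rightarrow> 'a)"
  by (rule bounded_linear_intro[where K = 1]) (auto simp: star_add star_scaleR)

lemmas tendsto_star [tendsto_intros] = bounded_linear.tendsto[OF bounded_linear_star]

text \<open>The square root of \<open>1 - b\<close> is \<open>1 - w\<close>, where \<open>w\<close> solves \<open>w = (b + w\<^sup>2) / 2\<close>. The fixed
  point iteration is majorised by the same iteration for the scalar \<open>b = 1\<close>, which is increasing and
  bounded by \<open>1\<close>; so it converges also on the boundary \<open>\<parallel>b\<parallel> = 1\<close>.\<close>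

lemma cstar_sqrt_unit:
  fixes a :: "'a::cstar_algebra"
  assumes sa: "star a = a" and na: "norm (1 - a) \<le> 1"
  obtains s where "s * s = a" "star s = s" "norm (1 - s) \<le> 1"
    "\<And>z. z * a = a * z \<Longrightarrow> z * s = s * z"
proof -
  define b where "b = 1 - a"
  define w :: "nat \<Rightarrow> 'a" where "w = rec_nat 0 (\<lambda>_ v. (1/2) *\<^sub>R (b + v * v))"
  define t :: "nat \<Rightarrow> real" where "t = rec_nat 0 (\<lambda>_ v. (1 + v * v) / 2)"
  have w0: "w 0 = 0" and wS: "w (Suc n) = (1/2) *\<^sub>R (b + w n * w n)" for n
    by (simp_all add: w_def)
  have t0: "t 0 = 0" and tS: "t (Suc n) = (1 + t n * t n) / 2" for n
    by (simp_all add: t_def)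
  have t01: "0 \<le> t n \<and> t n \<le> 1" for n
  proof (induction n)
    case (Suc n)
    then have "t n * t n \<le> 1" by (simp add: mult_le_one)
    then show ?case using Suc by (simp add: tS)
  qed (simp add: t0)
  \<comment> \<open>The increment is (1 - t n)^2 / 2.\<close>
  have tinc: "t n \<le> t (Suc n)" for n
    using zero_le_power2[of "1 - t n"] by (simp add: tS power2_eq_square algebra_simps)
  \<comment> \<open>Each iterate is a polynomial in \<open>a\<close>. The commutation is exported in
    the conclusion because later arguments multiply roots of different elements.\<close>
  have comm: "z * w n = w n * z" if "z * a = a * z" for z n
  proof (induction n)
    case (Suc n)
    have "z * (w n * w n) = (w n * w n) * z" by (metis Suc mult.assoc)
    moreover have "z * b = b * z" using that by (simp add: b_def algebra_simps)
    ultimately show ?case by (simp add: wS algebra_simps)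
  qed (simp add: w0)
  have wa: "w n * a = a * w n" for n using comm[of a n] by simp
  have ww: "w m * w n = w n * w m" for m n using comm[OF wa] .
  have nw: "norm (w n) \<le> t n" for n
  proof (induction n)
    case (Suc n)
    have "norm (w n * w n) \<le> t n * t n"
      by (rule order_trans[OF norm_mult_ineq]) (simp add: Suc mult_mono t01)
    moreover have "norm b \<le> 1" using na by (simp add: b_def)
    ultimately have "norm (b + w n * w n) \<le> 1 + t n * t n"
      by (meson add_mono norm_triangle_le)
    then show ?case by (simp add: wS tS)
  qed (simp add: w0 t0)
  have nd: "norm (w (Suc n) - w n) \<le> t (Suc n) - t n" for n
  proof (induction n)
    case 0
    then show ?case using na by (simp add: wS tS w0 t0 b_def)
  next
    case (Suc n)
    have "w (Suc (Suc n)) - w (Suc n) = (1/2) *\<^sub>R (w (Suc n) * w (Suc n) - w n * w n)"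
      by (simp add: wS[of "Suc n"] wS[of n] scaleR_right_diff_distrib[symmetric])
    \<comment> \<open>The iterates commute, so the difference of squares factors; the same
      factorisation for t makes the two estimates match.\<close>
    also have "w (Suc n) * w (Suc n) - w n * w n = (w (Suc n) - w n) * (w (Suc n) + w n)"
      using ww[of n "Suc n"] by (simp add: algebra_simps)
    finally have "norm (w (Suc (Suc n)) - w (Suc n))
        \<le> (1/2) * (norm (w (Suc n) - w n) * norm (w (Suc n) + w n))"
      by (simp add: norm_mult_ineq)
    also have "\<dots> \<le> (1/2) * ((t (Suc n) - t n) * (t (Suc n) + t n))"
      using Suc nw[of n] nw[of "Suc n"] tinc[of n]
      by (intro mult_left_mono mult_mono) (auto intro: norm_triangle_le add_mono)
    also have "\<dots> = t (Suc (Suc n)) - t (Suc n)"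
      by (simp add: tS[of "Suc n"] tS[of n] field_simps)
    finally show ?case .
  qed
  have nwt: "norm (w (n + k) - w n) \<le> t (n + k) - t n" for n k
  proof (induction k)
    case (Suc k)
    have "norm (w (n + Suc k) - w n) \<le> norm (w (Suc (n + k)) - w (n + k)) + norm (w (n + k) - w n)"
      using norm_triangle_ineq[of "w (Suc (n + k)) - w (n + k)" "w (n + k) - w n"] by simp
    then show ?case using Suc nd[of "n + k"] by simp
  qed simp
  have "Bseq t" using t01 by (intro BseqI'[of _ 1]) auto
  then have "Cauchy t"
    using Bseq_monoseq_convergent[of t] incseq_SucI[of t] tinc
    by (simp add: Cauchy_convergent_iff incseq_imp_monoseq)
  have "Cauchy w"
  proof (rule metric_CauchyI)
    fix e :: real assume "e > 0"
    then obtain M where M: "\<And>m n. m \<ge> M \<Longrightarrow> n \<ge> M \<Longrightarrow> dist (t m) (t n) < e"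
      using metric_CauchyD[OF \<open>Cauchy t\<close>] by blast
    have *: "dist (w m) (w n) < e" if "m \<ge> M" "n \<ge> m" for m n
    proof -
      have "norm (w n - w m) \<le> t n - t m" using nwt[of m "n - m"] that by simp
      also have "\<dots> < e" using M[of n m] that by (auto simp: dist_real_def)
      finally show ?thesis by (simp add: dist_norm norm_minus_commute)
    qed
    show "\<exists>M. \<forall>m\<ge>M. \<forall>n\<ge>M. dist (w m) (w n) < e"
      by (rule exI[of _ M]) (metis * dist_commute nle_le)
  qed
  then obtain v where v: "w \<longlonglongrightarrow> v" using Cauchy_convergent_iff convergent_def by blast
  have v2: "v = (1/2) *\<^sub>R (b + v * v)"
  proof (rule LIMSEQ_unique[OF LIMSEQ_Suc[OF v]])
    show "(\<lambda>n. w (Suc n)) \<longlonglongrightarrow> (1/2) *\<^sub>R (b + v * v)"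
      unfolding wS by (intro tendsto_intros v)
  qed
  have "v + v = 2 *\<^sub>R v" by (simp add: scaleR_2)
  also have "\<dots> = b + v * v" by (subst v2) simp
  finally have sq: "(1 - v) * (1 - v) = a" by (simp add: b_def algebra_simps)
  have sw: "star (w n) = w n" for n
    by (induction n) (auto simp: w0 wS star_scaleR star_add star_mult b_def star_diff sa)
  have "star v = v"
    using LIMSEQ_unique[OF v tendsto_star[OF v, unfolded sw]] by simp
  moreover have "norm v \<le> 1"
    by (rule LIMSEQ_le_const2[OF tendsto_norm[OF v]]) (meson t01 nw order_trans)
  moreover have vz: "z * v = v * z" if "z * a = a * z" for z
  proof (rule LIMSEQ_unique[OF tendsto_mult_left[OF v, of z]])
    show "(\<lambda>n. z * w n) \<longlonglongrightarrow> v * z"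
      unfolding comm[OF that] by (rule tendsto_mult_right[OF v])
  qed
  moreover have "z * (1 - v) = (1 - v) * z" if "z * a = a * z" for z
    using vz[OF that] by (simp add: right_diff_distrib left_diff_distrib)
  ultimately show thesis
    by (intro that[of "1 - v"] sq) (auto simp: star_diff)
qed

text \<open>Here \<open>h + \<i> s\<close> is unitary, with real part \<open>h\<close>.\<close>

lemma norm_le_1_of_square_sum:
  fixes h s :: "'a::cstar_algebra"
  assumes "star h = h" "star s = s" and hs: "h * s = s * h" and one: "h * h + s * s = 1"
  shows "norm h \<le> 1"
proof -
  define u where "u = h + \<i> *\<^sub>C s"
  have su: "star u = h + (- \<i>) *\<^sub>C s" by (simp add: u_def star_add star_scaleC assms)
  have neg: "(- \<i>) *\<^sub>C x + \<i> *\<^sub>C x = 0" for x :: 'a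
    by (metis scaleC_add_left add.left_inverse scaleR_scaleC of_real_0 scaleR_zero_left)
  have one': "1 *\<^sub>C x = x" for x :: 'a using scaleR_scaleC[of 1 x] by simp
  have "star u * u = h * h + s * s + ((- \<i>) *\<^sub>C (h * s) + \<i> *\<^sub>C (h * s))"
  proof -
    have 1: "((- \<i>) *\<^sub>C s) * (\<i> *\<^sub>C s) = s * s"
      by (simp add: mult_scaleC_left mult_scaleC_right scaleC_scaleC one')
    have 2: "((- \<i>) *\<^sub>C s) * h = (- \<i>) *\<^sub>C (h * s)" "h * (\<i> *\<^sub>C s) = \<i> *\<^sub>C (h * s)"
      by (simp_all add: mult_scaleC_left mult_scaleC_right hs)
    show ?thesis
      unfolding su unfolding u_def by (simp only: distrib_left distrib_right 1 2 ac_simps)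
  qed
  then have "star u * u = 1" by (simp only: neg one add_0_right)
  then have nu: "norm u = 1" using norm_star_mult[of u] norm_ge_zero[of u]
    by (auto simp: power2_eq_1_iff simp del: norm_ge_zero)
  have "u + star u = h + h + ((- \<i>) *\<^sub>C s + \<i> *\<^sub>C s)"
    unfolding su unfolding u_def by (simp only: ac_simps)
  then have "2 * norm h = norm (u + star u)" by (simp only: neg scaleR_2[symmetric]) simp
  also have "\<dots> \<le> 2" using norm_triangle_ineq[of u "star u"] nu by simp
  finally show ?thesis by simp
qed

text \<open>The root s of 1 - h^2 commutes with h, and the two squares add up to 1. So s has norm at
  most 1 as well, and the norm of 1 - h^2 is the square of that of s. This stands in for the fact
  that h^2 has nonnegative spectrum.\<close>

lemma norm_one_minus_square_le:
  fixes h :: "'a::cstar_algebra"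
  assumes "star h = h" "norm h \<le> 1"
  shows "norm (1 - h * h) \<le> 1"
proof -
  have "star (1 - h * h) = 1 - h * h" using assms by (simp add: star_diff star_mult)
  moreover have "norm (1 - (1 - h * h)) \<le> 1"
    using norm_selfadjoint_square[OF assms(1)] assms(2) by (simp add: power_le_one)
  ultimately obtain s where s: "s * s = 1 - h * h" "star s = s"
    "\<And>z. z * (1 - h * h) = (1 - h * h) * z \<Longrightarrow> z * s = s * z"
    using cstar_sqrt_unit by blast
  have "h * s = s * h" by (rule s(3)) (simp add: algebra_simps)
  then have "norm s \<le> 1" by (intro norm_le_1_of_square_sum[of s h]) (auto simp: s assms)
  then show ?thesis
    using norm_selfadjoint_square[OF s(2)] s(1) by (simp add: power_le_one)
qed

section \<open>The positive cone, described by norms\<close>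

text \<open>Asking for a self-adjoint root makes \<open>a\<close> visibly self-adjoint and lets
  \<open>norm_one_minus_square_le\<close> apply. That this is the usual cone of elements
  \<open>star x * x\<close> is the later theorem \<open>pos_elem_star_mult\<close>.\<close>

definition pos_elem :: "'a::cstar_algebra \<Rightarrow> bool" where
  "pos_elem a \<longleftrightarrow> (\<exists>h. star h = h \<and> a = h * h)"

lemma pos_elem_selfadjoint: "pos_elem a \<Longrightarrow> star a = a"
  by (auto simp: pos_elem_def star_mult)

lemma pos_elem_square: "star h = h \<Longrightarrow> pos_elem (h * h)"
  by (auto simp: pos_elem_def)

lemma pos_elem_of_real [simp]: "r \<ge> 0 \<Longrightarrow> pos_elem (of_real r)"
  using pos_elem_square[of "of_real (sqrt r)"] by (simp add: of_real_mult[symmetric] del: of_real_mult)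

lemma pos_elem_0 [simp]: "pos_elem 0" and pos_elem_1 [simp]: "pos_elem 1"
  using pos_elem_of_real[of 0] pos_elem_of_real[of 1] by simp_all

lemma pos_elem_scaleR: "r \<ge> 0 \<Longrightarrow> pos_elem a \<Longrightarrow> pos_elem (r *\<^sub>R a)"
  unfolding pos_elem_def
proof safe
  fix h :: 'a assume "r \<ge> 0" "star h = h"
  then show "\<exists>k. star k = k \<and> r *\<^sub>R (h * h) = k * k"
    by (intro exI[of _ "sqrt r *\<^sub>R h"]) (simp add: star_scaleR)
qed

text \<open>Scaling to t = 1 reduces this to \<open>norm_one_minus_square_le\<close>. With the
  converse \<open>pos_elemI\<close> it gives the norm test for positivity.\<close>

lemma pos_elem_norm_le:
  assumes "pos_elem a" "norm a \<le> t"
  shows "norm (of_real t - a) \<le> t"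
proof (cases "t = 0")
  case False
  then have t: "t > 0" using assms(2) norm_ge_zero[of a] by linarith
  obtain h where h: "star h = h" "a = h * h" using assms(1) by (auto simp: pos_elem_def)
  define k where "k = (1 / sqrt t) *\<^sub>R h"
  have k: "star k = k" using h by (simp add: k_def star_scaleR)
  have kk: "a = t *\<^sub>R (k * k)" using t by (simp add: k_def h)
  have "(norm k)\<^sup>2 = norm (k * k)" using norm_selfadjoint_square[OF k] by simp
  also have "\<dots> \<le> 1" using assms(2) t by (simp add: kk)
  finally have "norm k \<le> 1" using power2_le_imp_le[of "norm k" 1] by simp
  then have "norm (1 - k * k) \<le> 1" by (rule norm_one_minus_square_le[OF k])
  moreover have "of_real t - a = t *\<^sub>R (1 - k * k)"
    by (simp add: kk of_real_def scaleR_right_diff_distrib)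
  ultimately show ?thesis using t by simp
qed (use assms in simp)

text \<open>The estimate for s has the form of the hypothesis with sqrt t in place of t, so by the
  same test the root is itself positive.\<close>

lemma pos_elem_sqrt_aux:
  fixes a :: "'a::cstar_algebra"
  assumes "star a = a" "norm (of_real t - a) \<le> t"
  obtains s where "s * s = a" "star s = s" "norm (of_real (sqrt t) - s) \<le> sqrt t"
    "\<And>z. z * a = a * z \<Longrightarrow> z * s = s * z"
proof (cases "t = 0")
  case True
  then show thesis using assms that[of 0] by simp
next
  case False
  then have t: "t > 0" using assms(2) norm_ge_zero[of "of_real t - a"] by linarith
  define b where "b = (1/t) *\<^sub>R a"
  have a: "a = t *\<^sub>R b" using t by (simp add: b_def)
  have "star b = b" using assms by (simp add: b_def star_scaleR)
  moreover have "norm (1 - b) \<le> 1"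
  proof -
    have "of_real t - a = t *\<^sub>R (1 - b)" by (simp add: a of_real_def scaleR_right_diff_distrib)
    then show ?thesis using assms(2) t by simp
  qed
  ultimately obtain s where s: "s * s = b" "star s = s" "norm (1 - s) \<le> 1"
    "\<And>z. z * b = b * z \<Longrightarrow> z * s = s * z"
    using cstar_sqrt_unit by blast
  have "of_real (sqrt t) - sqrt t *\<^sub>R s = sqrt t *\<^sub>R (1 - s)"
    by (simp add: of_real_def scaleR_right_diff_distrib)
  then have "norm (of_real (sqrt t) - sqrt t *\<^sub>R s) \<le> sqrt t"
    using s(3) t by (simp add: mult_left_le)
  moreover have "z * sqrt t *\<^sub>R s = sqrt t *\<^sub>R s * z" if "z * a = a * z" for z
    using s(4)[of z] that by (simp add: b_def)
  moreover have "(sqrt t *\<^sub>R s) * (sqrt t *\<^sub>R s) = a" using t s(1) by (simp add: a)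
  moreover have "star (sqrt t *\<^sub>R s) = sqrt t *\<^sub>R s" using s(2) by (simp add: star_scaleR)
  ultimately show thesis by (intro that[of "sqrt t *\<^sub>R s"])
qed

lemma pos_elemI: "star a = a \<Longrightarrow> norm (of_real t - a) \<le> t \<Longrightarrow> pos_elem a"
  by (metis pos_elem_sqrt_aux pos_elem_square)

lemma pos_elem_sqrt:
  fixes a :: "'a::cstar_algebra"
  assumes "pos_elem a"
  obtains s where "s * s = a" "pos_elem s" "\<And>z. z * a = a * z \<Longrightarrow> z * s = s * z"
  using pos_elem_sqrt_aux[of a "norm a"] pos_elem_norm_le[OF assms order_refl]
    pos_elem_selfadjoint[OF assms] pos_elemI by metis

text \<open>A sum of squares is not visibly a square; but the norm test adds up by the triangle
  inequality, with t the sum of the two norms.\<close>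

lemma pos_elem_add:
  fixes a b :: "'a::cstar_algebra"
  assumes "pos_elem a" "pos_elem b"
  shows "pos_elem (a + b)"
proof (rule pos_elemI)
  show "star (a + b) = a + b" using assms by (simp add: star_add pos_elem_selfadjoint)
  have "norm (of_real (norm a) - a + (of_real (norm b) - b)) \<le> norm a + norm b"
    using pos_elem_norm_le[OF assms(1) order_refl] pos_elem_norm_le[OF assms(2) order_refl]
    by (intro norm_triangle_le add_mono)
  then show "norm (of_real (norm a + norm b) - (a + b)) \<le> norm a + norm b"
    by (simp add: algebra_simps)
qed

lemma pos_elem_sum: "(\<And>i. i \<in> I \<Longrightarrow> pos_elem (f i)) \<Longrightarrow> pos_elem (sum f I)"
  by (induction I rule: infinite_finite_induct) (auto simp: pos_elem_add)

text \<open>Applied to t - a, the norm test asks only that the norm of \<open>a\<close> be at most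
  t.\<close>

lemma pos_elem_norm_minus: "pos_elem a \<Longrightarrow> norm a \<le> t \<Longrightarrow> pos_elem (of_real t - a)"
proof (rule pos_elemI[where t = t])
  assume "pos_elem a" "norm a \<le> t"
  moreover from this have "norm (of_real t - (of_real t - a)) \<le> t" by simp
  ultimately show "star (of_real t - a) = of_real t - a" "norm (of_real t - (of_real t - a)) \<le> t"
    by (auto simp: star_diff pos_elem_selfadjoint)
qed

text \<open>For t = 1 the roots of \<open>a\<close> and 1 - a commute and their squares add up to 1,
  so \<open>norm_le_1_of_square_sum\<close> bounds the root of \<open>a\<close>.\<close>

lemma norm_le_of_pos_elem_diff:
  fixes a :: "'a::cstar_algebra"
  assumes "pos_elem a" "pos_elem (of_real t - a)" "t \<ge> 0"
  shows "norm a \<le> t"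
proof -
  have *: "norm a \<le> 1" if a: "pos_elem a" "pos_elem (1 - a)" for a :: 'a
  proof -
    obtain h where h: "h * h = a" "pos_elem h"
      using pos_elem_sqrt[OF a(1)] by blast
    obtain s where s: "s * s = 1 - a" "pos_elem s" "\<And>z. z * (1 - a) = (1 - a) * z \<Longrightarrow> z * s = s * z"
      using pos_elem_sqrt[OF a(2)] by blast
    have "h * a = a * h" by (metis h(1) mult.assoc)
    then have hs: "h * s = s * h" by (intro s(3)) (simp add: algebra_simps)
    have sh: "star h = h" "star s = s" by (rule pos_elem_selfadjoint, fact)+
    have "norm h \<le> 1" by (rule norm_le_1_of_square_sum[OF sh hs]) (simp add: h s)
    then show ?thesis
      using norm_selfadjoint_square[OF sh(1)] h(1) by (simp add: power_le_one)
  qed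
  show ?thesis
  proof (rule field_le_epsilon)
    \<comment> \<open>Dividing by t + e instead of t covers t = 0.\<close>
    fix e :: real assume "e > 0"
    define r where "r = t + e"
    have r: "r > 0" using assms(3) \<open>e > 0\<close> by (simp add: r_def)
    have "pos_elem (of_real t - a + of_real e)" using assms \<open>e > 0\<close> by (intro pos_elem_add) auto
    then have "pos_elem (of_real r - a)" by (simp add: r_def algebra_simps)
    moreover have "(1/r) *\<^sub>R (of_real r - a) = 1 - (1/r) *\<^sub>R a"
      using r by (simp add: of_real_def scaleR_right_diff_distrib)
    ultimately have "pos_elem (1 - (1/r) *\<^sub>R a)"
      using r by (metis pos_elem_scaleR zero_le_divide_1_iff less_imp_le)
    then have "norm ((1/r) *\<^sub>R a) \<le> 1"
      using r assms(1) by (intro *) (auto intro: pos_elem_scaleR)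
    then show "norm a \<le> t + e" using r by (simp add: r_def)
  qed
qed

text \<open>In the order of the cone, a \<le> a + b \<le> norm (a + b).\<close>

lemma pos_elem_norm_mono:
  assumes "pos_elem a" "pos_elem b"
  shows "norm a \<le> norm (a + b)"
proof (rule norm_le_of_pos_elem_diff)
  have "pos_elem (of_real (norm (a + b)) - (a + b) + b)"
    using assms by (intro pos_elem_add pos_elem_norm_minus) auto
  then show "pos_elem (of_real (norm (a + b)) - a)" by simp
qed (use assms in auto)

lemma pos_elem_antisym: "pos_elem a \<Longrightarrow> pos_elem (- a) \<Longrightarrow> a = 0"
  using pos_elem_norm_mono[of a "- a"] by simp

text \<open>With t the norm of the element, the norm test is an inequality between continuous
  functions.\<close>

lemma pos_elem_lim:
  assumes "f \<longlonglongrightarrow> a" "\<And>n. pos_elem (f n)"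
  shows "pos_elem a"
proof (rule pos_elemI)
  show "star a = a"
    using LIMSEQ_unique[OF tendsto_star[OF assms(1)]] assms by (simp add: pos_elem_selfadjoint)
  have "(\<lambda>n. norm (of_real (norm (f n)) - f n)) \<longlonglongrightarrow> norm (of_real (norm a) - a)"
    by (intro tendsto_intros assms)
  then show "norm (of_real (norm a) - a) \<le> norm a"
    by (rule LIMSEQ_le[OF _ tendsto_norm[OF assms(1)]])
      (auto intro: pos_elem_norm_le assms)
qed

text \<open>With \<open>g = 1 - x\<^sup>* x / T\<close>, the norms of \<open>T (g\<^sup>n - g\<^sup>n\<^sup>+\<^sup>1) = x\<^sup>* (1 - x x\<^sup>* / T)\<^sup>n x\<close> stay
  bounded, so \<open>\<parallel>g\<^sup>n\<parallel>\<close> grows at most linearly; since \<open>g\<close> is self-adjoint, \<open>\<parallel>g\<parallel> \<le> 1\<close>.\<close>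

lemma pos_elem_star_mult_swap:
  fixes x :: "'a::cstar_algebra"
  assumes "pos_elem (x * star x)"
  shows "pos_elem (star x * x)"
proof -
  \<comment> \<open>The summand 1 keeps T positive when x = 0.\<close>
  define T where "T = norm (x * star x) + 1"
  have T: "T > 0" by (simp add: T_def add_nonneg_pos)
  define g where "g = 1 - (1/T) *\<^sub>R (star x * x)"
  define k where "k = 1 - (1/T) *\<^sub>R (x * star x)"
  have "norm (of_real T - x * star x) \<le> T" by (intro pos_elem_norm_le assms) (simp add: T_def)
  also have "of_real T - x * star x = T *\<^sub>R k"
    using T by (simp add: k_def of_real_def scaleR_right_diff_distrib)
  finally have nk: "norm k \<le> 1" using T by simp
  have nkn: "norm (k ^ n) \<le> 1" for n
    by (rule order_trans[OF norm_power_ineq]) (simp add: nk power_le_one)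
  have sg: "star g = g" by (simp add: g_def star_diff star_scaleR star_mult star_star)
  have kx: "star x * k ^ n = g ^ n * star x" for n
  proof (induction n)
    case (Suc n)
    have "star x * k = g * star x" by (simp add: g_def k_def algebra_simps)
    then show ?case using Suc by (simp add: mult.assoc[symmetric]) (simp add: mult.assoc)
  qed simp
  define K where "K = (norm x)\<^sup>2 / T"
  have step: "norm (g ^ Suc n - g ^ n) \<le> K" for n
  proof -
    have "g ^ n - g ^ Suc n = g ^ n * (1 - g)" by (simp add: algebra_simps power_commutes)
    also have "\<dots> = (1/T) *\<^sub>R (g ^ n * star x * x)" by (simp add: g_def mult.assoc)
    also have "\<dots> = (1/T) *\<^sub>R (star x * k ^ n * x)" by (simp add: kx)
    finally have "norm (g ^ n - g ^ Suc n) = (1/T) * norm (star x * k ^ n * x)" using T by simp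
    also have "norm (star x * k ^ n * x) \<le> norm (star x) * norm (k ^ n) * norm x"
      by (meson norm_mult_ineq order_trans mult_right_mono norm_ge_zero)
    also have "\<dots> \<le> norm x * 1 * norm x" by (intro mult_mono) (auto simp: nkn)
    finally show ?thesis using T by (simp add: K_def norm_minus_commute power2_eq_square field_simps)
  qed
  have lin: "norm (g ^ n) \<le> 1 + real n * K" for n
  proof (induction n)
    case (Suc n)
    have "norm (g ^ Suc n) \<le> norm (g ^ Suc n - g ^ n) + norm (g ^ n)"
      using norm_triangle_ineq[of "g ^ Suc n - g ^ n" "g ^ n"] by simp
    then show ?case using Suc step[of n] by (simp add: algebra_simps)
  qed simp
  \<comment> \<open>The identity for self-adjoint elements only covers squaring, hence the exponents
    2 ^ m.\<close>
  have pw: "norm (g ^ (2 ^ m)) = norm g ^ (2 ^ m)" for m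
  proof (induction m)
    case (Suc m)
    have "norm (g ^ (2 ^ m) * g ^ (2 ^ m)) = (norm (g ^ (2 ^ m)))\<^sup>2"
      by (rule norm_selfadjoint_square) (simp add: star_power sg)
    then show ?case using Suc by (simp add: power_add[symmetric] mult_2 power2_eq_square)
  qed simp
  have "norm g \<le> 1"
  proof (rule ccontr)
    assume "\<not> norm g \<le> 1"
    then have gt: "norm g > 1" by simp
    define c where "c = norm g - 1"
    have c: "c > 0" using gt by (simp add: c_def)
    have K0: "K \<ge> 0" using T by (simp add: K_def)
    \<comment> \<open>At the exponent 2 N, Bernoulli's inequality for N, squared, gives growth of
      order N^2 c^2, against the linear bound 1 + 2 N K. This fails once N c^2 exceeds 1 + 2 K,
      which N = 2 ^ m > m ensures.\<close>
    obtain m :: nat where m: "real m > (1 + 2 * K) / c\<^sup>2" using reals_Archimedean2 by blast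
    define N where "N = (2::nat) ^ m"
    have "real m < real N" unfolding N_def by (metis of_nat_less_iff less_exp)
    have N1: "real N \<ge> 1" by (simp add: N_def)
    have "norm g ^ (2 ^ Suc m) \<le> 1 + real (2 * N) * K"
      using lin[of "2 ^ Suc m"] pw[of "Suc m"] by (simp add: N_def)
    moreover have "norm g ^ (2 ^ Suc m) = (norm g ^ N)\<^sup>2" by (simp add: N_def power_mult[symmetric] mult.commute)
    moreover have "1 + real N * c \<le> norm g ^ N"
      using Bernoulli_inequality[of c N] c by (simp add: c_def)
    then have "(1 + real N * c)\<^sup>2 \<le> (norm g ^ N)\<^sup>2" using c by (intro power_mono) auto
    ultimately have "(1 + real N * c)\<^sup>2 \<le> 1 + real (2 * N) * K" by simp
    moreover have "(real N * c)\<^sup>2 \<le> (1 + real N * c)\<^sup>2" using c by (intro power_mono) auto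
    moreover have "1 + real (2 * N) * K \<le> real N * (1 + 2 * K)" using N1 by (simp add: algebra_simps)
    ultimately have "real N * (real N * c\<^sup>2) \<le> real N * (1 + 2 * K)"
      by (simp add: power2_eq_square algebra_simps)
    then have "real N * c\<^sup>2 \<le> 1 + 2 * K" using N1 by simp
    moreover have "1 + 2 * K < real m * c\<^sup>2" using m c by (simp add: pos_divide_less_eq)
    moreover have "real m * c\<^sup>2 \<le> real N * c\<^sup>2" using \<open>real m < real N\<close> by (intro mult_right_mono) auto
    ultimately show False by simp
  qed
  then have "norm (T *\<^sub>R g) \<le> T" using T by simp
  also have "T *\<^sub>R g = of_real T - star x * x"
    using T by (simp add: g_def of_real_def scaleR_right_diff_distrib)
  finally show ?thesis by (intro pos_elemI) (auto simp: star_mult star_star)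
qed

text \<open>For \<open>a = x\<^sup>* x\<close>, the element \<open>v = (\<bar>a\<bar> - a) / 2\<close> satisfies \<open>v a v = - v\<^sup>3\<close> and \<open>v\<^sup>3 \<ge> 0\<close>.
  With \<open>y = x v = h + \<i> k\<close> one gets \<open>y\<^sup>* y = - v\<^sup>3\<close> and \<open>y y\<^sup>* = 2 h\<^sup>2 + 2 k\<^sup>2 + v\<^sup>3 \<ge> 0\<close>, hence
  \<open>- v\<^sup>3 \<ge> 0\<close> and \<open>v = 0\<close>.\<close>

theorem pos_elem_star_mult: "pos_elem (star x * (x::'a::cstar_algebra))"
proof -
  define a where "a = star x * x"
  have sa: "star a = a" by (simp add: a_def star_mult star_star)
  obtain b where b: "b * b = a * a" "pos_elem b" "\<And>z. z * (a * a) = (a * a) * z \<Longrightarrow> z * b = b * z"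
    using pos_elem_sqrt[OF pos_elem_square[OF sa]] by blast
  have ab: "a * b = b * a" by (rule b(3)) (simp add: mult.assoc)
  obtain p where p: "p * p = b" "pos_elem p" "\<And>z. z * b = b * z \<Longrightarrow> z * p = p * z"
    using pos_elem_sqrt[OF b(2)] by blast
  define v where "v = (1/2) *\<^sub>R (b - a)"
  have sv: "star v = v" by (simp add: v_def star_scaleR star_diff sa pos_elem_selfadjoint[OF b(2)])
  have vb: "v * b = b * v" using ab by (simp add: v_def algebra_simps)
  have vp: "v * p = p * v" by (rule p(3)[OF vb])
  \<comment> \<open>Since b^2 = a^2 and the two commute, (b - a)^2 = 2 b (b - a): on v, the absolute
    value b acts as v.\<close>
  have vv: "v * v = b * v"
  proof -
    have "(b - a) * (b - a) = 2 *\<^sub>R (b * (b - a))"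
      using ab b(1) by (simp add: scaleR_2 algebra_simps)
    then show ?thesis by (simp add: v_def)
  qed
  have av: "a = b - (v + v)" by (simp add: v_def scaleR_2[symmetric])
  \<comment> \<open>v^3 = b v^2, and the root p of b commutes with v; so v^3 is the square of the
    self-adjoint p v.\<close>
  have v3: "v * v * v = (p * v) * (p * v)"
    by (metis vv vp p(1) mult.assoc)
  have pv3: "pos_elem (v * v * v)"
    unfolding v3 by (rule pos_elem_square) (simp add: star_mult sv pos_elem_selfadjoint[OF p(2)] vp)
  have "v * a * v = v * b * v - (v * v * v + v * v * v)" by (simp add: av algebra_simps)
  also have "v * b * v = v * v * v" using vv vb by (simp add: mult.assoc)
  finally have vav: "v * a * v = - (v * v * v)" by simp
  define y where "y = x * v"
  have yy: "star y * y = - (v * v * v)"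
    using vav by (simp add: y_def star_mult sv a_def mult.assoc)
  \<comment> \<open>The real and imaginary parts of y; the sum of their squares is half of
    \<open>star y * y + y * star y\<close>.\<close>
  define h where "h = (1/2) *\<^sub>R (y + star y)"
  define k where "k = (1/2) *\<^sub>R (\<i> *\<^sub>C (star y - y))"
  have one: "1 *\<^sub>C z = z" for z :: 'a using scaleR_scaleC[of 1 z] by simp
  have mone: "(-1) *\<^sub>C z = - z" for z :: 'a using scaleR_scaleC[of "-1" z] by simp
  have hs: "star h = h" by (simp add: h_def star_scaleR star_add star_star add.commute)
  have "star (\<i> *\<^sub>C (star y - y)) = (- \<i>) *\<^sub>C (y - star y)" by (simp add: star_scaleC star_diff star_star)
  also have "\<dots> = (\<i> * (-1)) *\<^sub>C (y - star y)" by simp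
  also have "\<dots> = \<i> *\<^sub>C (star y - y)" by (simp only: scaleC_scaleC[symmetric] mone) simp
  finally have ks: "star k = k" by (simp add: k_def star_scaleR)
  have "(\<i> *\<^sub>C (star y - y)) * (\<i> *\<^sub>C (star y - y)) = - ((star y - y) * (star y - y))"
    by (simp add: mult_scaleC_left mult_scaleC_right scaleC_scaleC mone)
  then have kk: "k * k = - ((1/4) *\<^sub>R ((star y - y) * (star y - y)))" by (simp add: k_def)
  have hh: "h * h = (1/4) *\<^sub>R ((y + star y) * (y + star y))" by (simp add: h_def)
  have "4 *\<^sub>R (h * h + k * k) = (y + star y) * (y + star y) - (star y - y) * (star y - y)"
    by (simp add: hh kk scaleR_right_diff_distrib)
  also have "\<dots> = 2 *\<^sub>R (star y * y + y * star y)" by (simp add: scaleR_2 algebra_simps)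
  finally have "2 *\<^sub>R (2 *\<^sub>R (h * h + k * k)) = 2 *\<^sub>R (star y * y + y * star y)"
    unfolding scaleR_scaleR by simp
  then have "2 *\<^sub>R (h * h + k * k) = star y * y + y * star y"
    by (rule scaleR_left_imp_eq[rotated]) simp
  then have "y * star y = 2 *\<^sub>R (h * h + k * k) + v * v * v" by (simp add: yy)
  then have "pos_elem (y * star y)"
    using hs ks pv3 by (auto intro!: pos_elem_add pos_elem_scaleR pos_elem_square)
  then have "pos_elem (- (v * v * v))" using pos_elem_star_mult_swap yy by metis
  then have "v * v * v = 0" using pos_elem_antisym pv3 by blast
  then have "(v * v) * (v * v) = 0" by (metis mult.assoc mult_zero_right mult_zero_left)
  moreover have "star (v * v) = v * v" by (simp add: star_mult sv)
  ultimately have "v * v = 0" using norm_selfadjoint_square by force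
  then have "v = 0" using norm_selfadjoint_square[OF sv] by simp
  then show ?thesis using b(2) av a_def by simp
qed

text \<open>With a = h * h the conjugate is \<open>star (h * y) * (h * y)\<close>, and h * y need
  not be self-adjoint.\<close>

lemma pos_elem_conj:
  assumes "pos_elem a"
  shows "pos_elem (star y * a * y)"
proof -
  obtain h where "star h = h" "a = h * h" using assms by (auto simp: pos_elem_def)
  then have "star y * a * y = star (h * y) * (h * y)" by (simp add: star_mult mult.assoc)
  then show ?thesis by (simp add: pos_elem_star_mult)
qed

text \<open>The algebraic core of the Cauchy--Schwarz inequality for algebra-valued inner products:
  take \<open>p = \<langle>x, x\<rangle>\<close>, \<open>q = \<langle>x, y\<rangle>\<close>, \<open>r = \<langle>y, y\<rangle>\<close>, so the hypothesis is
  \<open>\<langle>x a - y, x a - y\<rangle> \<ge> 0\<close>.\<close>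

lemma norm_square_le_of_pos_elem:
  assumes p: "pos_elem p" and r: "pos_elem r"
    and form: "\<And>a. pos_elem (star a * p * a - star a * q - star q * a + r)"
  shows "(norm q)\<^sup>2 \<le> norm p * norm r"
proof (rule field_le_epsilon)
  fix e :: real assume e: "e > 0"
  have *: "(norm q)\<^sup>2 \<le> t * norm r" if t: "t > 0" "norm p \<le> t" for t
  proof -
    \<comment> \<open>Once p is replaced by the scalar t \<ge> p, the quadratic form in
      \<open>a\<close> is minimal at q / t.\<close>
    define a where "a = (1/t) *\<^sub>R q"
    have "pos_elem (star a * (of_real t - p) * a)"
      using t by (intro pos_elem_conj pos_elem_norm_minus p)
    then have "pos_elem (star a * (of_real t - p) * a + (star a * p * a - star a * q - star q * a + r))"
      by (intro pos_elem_add[OF _ form])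
    also have "star a * (of_real t - p) * a + (star a * p * a - star a * q - star q * a + r)
        = t *\<^sub>R (star a * a) - star a * q - star q * a + r"
      by (simp add: of_real_def algebra_simps)
    also have "\<dots> = r - (1/t) *\<^sub>R (star q * q)"
      using t by (simp add: a_def star_scaleR)
    finally have "pos_elem (r - (1/t) *\<^sub>R (star q * q))" .
    then have "norm ((1/t) *\<^sub>R (star q * q)) \<le> norm ((1/t) *\<^sub>R (star q * q) + (r - (1/t) *\<^sub>R (star q * q)))"
      using t by (intro pos_elem_norm_mono pos_elem_scaleR pos_elem_star_mult) auto
    then show ?thesis using t by (simp add: norm_star_mult field_simps)
  qed
  \<comment> \<open>The slack keeps t positive when p = 0 and contributes at most e after
    multiplication by norm r.\<close>
  have "(norm q)\<^sup>2 \<le> (norm p + e / (norm r + 1)) * norm r"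
    using e by (intro *) (auto intro!: add_nonneg_pos divide_pos_pos)
  also have "\<dots> \<le> norm p * norm r + e"
    using e by (simp add: algebra_simps divide_simps add_pos_nonneg)
  finally show "(norm q)\<^sup>2 \<le> norm p * norm r + e" .
qed

section \<open>Inverses and comparison of positive elements\<close>

lemma neumann_inverse:
  fixes b :: "'a::{real_normed_algebra_1, banach}"
  assumes "norm b < 1"
  obtains q where "(1 - b) * q = 1" "q * (1 - b) = 1"
proof -
  have sm: "summable (\<lambda>n. b ^ n)"
    by (rule summable_comparison_test'[of "\<lambda>n. norm b ^ n" 0])
      (use assms in \<open>auto simp: norm_power_ineq\<close>)
  define q where "q = (\<Sum>n. b ^ n)"
  have "q = 1 + (\<Sum>n. b ^ Suc n)" using suminf_split_head[OF sm] by (simp add: q_def)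
  moreover have "(\<Sum>n. b ^ Suc n) = b * q" using suminf_mult[OF sm, of b] by (simp add: q_def)
  moreover have "(\<Sum>n. b ^ Suc n) = q * b"
    using suminf_mult2[OF sm, of b] by (simp add: q_def power_commutes)
  ultimately have "q = 1 + b * q" "q = 1 + q * b" by simp_all
  then show thesis by (intro that[of q]) (auto simp: algebra_simps)
qed

text \<open>With T = norm a + e, the element 1 - (a + e) / T equals (norm a - a) / T, of norm less
  than 1; so a + e is invertible. Its inverse times its root c inverts c.\<close>

lemma pos_elem_inverse_sqrt:
  fixes a :: "'a::cstar_algebra"
  assumes "pos_elem a" "e > 0"
  obtains c d where "c * c = a + of_real e" "star c = c" "star d = d" "c * d = 1" "d * c = 1"
proof -
  define T where "T = norm a + e"
  have T: "T > 0" using assms(2) by (simp add: T_def add_nonneg_pos)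
  define p where "p = a + of_real e"
  have pp: "pos_elem p" unfolding p_def using assms by (intro pos_elem_add) auto
  define b where "b = 1 - (1/T) *\<^sub>R p"
  have "T *\<^sub>R b = of_real (norm a) - a"
    using T by (simp add: b_def p_def T_def of_real_def scaleR_right_diff_distrib scaleR_left_distrib)
  then have "norm (T *\<^sub>R b) \<le> norm a" using pos_elem_norm_le[OF assms(1) order_refl] by simp
  also have "\<dots> < T" using assms(2) by (simp add: T_def)
  finally have "norm b < 1" using T by simp
  then obtain q where q: "(1 - b) * q = 1" "q * (1 - b) = 1" by (rule neumann_inverse)
  define r where "r = (1/T) *\<^sub>R q"
  have r: "p * r = 1" "r * p = 1" using q by (simp_all add: b_def r_def)
  obtain c where c: "c * c = p" "pos_elem c" using pos_elem_sqrt[OF pp] by metis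
  have sc: "star c = c" using c(2) by (rule pos_elem_selfadjoint)
  define d where "d = r * c"
  have dc: "d * c = 1" by (simp add: d_def mult.assoc c(1) r)
  have cd': "c * (c * r) = 1" by (simp add: mult.assoc[symmetric] c(1) r)
  have "d = d * (c * (c * r))" by (simp add: cd')
  also have "\<dots> = c * r" by (metis dc mult.assoc mult_1_left)
  finally have cd: "c * d = 1" using cd' by simp
  have "star d * c = star (c * d)" by (simp add: star_mult sc)
  have "star d = star d * c * d" using cd by (simp add: mult.assoc)
  also have "\<dots> = d" by (simp add: \<open>star d * c = star (c * d)\<close> cd)
  finally have "star d = d" .
  then show thesis using c(1) sc cd dc by (intro that[of c d]) (auto simp: p_def)
qed

text \<open>Choosing \<open>d = (a + e)\<^sup>-\<^sup>1\<^sup>/\<^sup>2\<close> gives \<open>d c d \<le> 1\<close>, that is \<open>c \<le> a + e\<close>.\<close>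

lemma pos_elem_diff_of_norm_le:
  fixes a c :: "'a::cstar_algebra"
  assumes a: "pos_elem a" and c: "pos_elem c"
    and le: "\<And>d. norm (star d * c * d) \<le> norm (star d * a * d)"
  shows "pos_elem (a - c)"
proof (rule pos_elem_lim)
  show "pos_elem (a + of_real (1 / real (Suc n)) - c)" for n
  proof -
    define e where "e = 1 / real (Suc n)"
    have e: "e > 0" by (simp add: e_def)
    obtain k d where k: "k * k = a + of_real e" "star k = k" and d: "star d = d" "k * d = 1" "d * k = 1"
      using pos_elem_inverse_sqrt[OF a e] by metis
    have 1: "star d * (a + of_real e) * d = 1"
      unfolding k(1)[symmetric] d(1) by (metis d mult.assoc mult_1_left)
    have "norm (star d * c * d) \<le> norm (star d * a * d)" by (rule le)
    also have "\<dots> \<le> norm (star d * a * d + star d * of_real e * d)"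
      using e a by (intro pos_elem_norm_mono pos_elem_conj) auto
    also have "\<dots> = 1" using 1 by (simp add: distrib_left distrib_right)
    finally have "pos_elem (of_real 1 - star d * c * d)"
      by (intro pos_elem_norm_minus pos_elem_conj c)
    \<comment> \<open>Conjugating by k, the inverse of d, undoes the conjugation by d.\<close>
    then have "pos_elem (star k * (1 - star d * c * d) * k)" by (intro pos_elem_conj) simp
    also have "star k * (1 - star d * c * d) * k = k * k - (k * d) * c * (d * k)"
      by (simp add: k(2) d(1) algebra_simps)
    finally show ?thesis by (simp add: d k(1) e_def)
  qed
  have "(\<lambda>n. of_real (1 / real (Suc n)) :: 'a) \<longlonglongrightarrow> of_real 0"
    using LIMSEQ_Suc[OF lim_1_over_n[where 'a = real]] by (rule tendsto_of_real)
  then have "(\<lambda>n. a + of_real (1 / real (Suc n)) - c) \<longlonglongrightarrow> a + of_real 0 - c"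
    by (intro tendsto_add tendsto_diff tendsto_const)
  then show "(\<lambda>n. a + of_real (1 / real (Suc n)) - c) \<longlonglongrightarrow> a - c"
    by (simp only: of_real_0 add_0_right)
qed

section \<open>Hilbert modules\<close>

text \<open>Negation comes from the action of -1, see \<open>act_minus_1\<close>. Completeness is
  kept as the separate predicate \<open>complete_hmodule\<close>, called on where the Neumann series
  has to converge.\<close>

locale ip_module =
  fixes H :: "('a::cstar_algebra, 'h::ab_group_add) hmodule"
  assumes zero_mem: "0 \<in> carrier H"
    and add_mem: "x \<in> carrier H \<Longrightarrow> y \<in> carrier H \<Longrightarrow> x + y \<in> carrier H"
    and act_mem: "x \<in> carrier H \<Longrightarrow> act H x a \<in> carrier H"
    and act_add_left: "x \<in> carrier H \<Longrightarrow> y \<in> carrier H \<Longrightarrow> act H (x + y) a = act H x a + act H y a"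
    and act_add_right: "x \<in> carrier H \<Longrightarrow> act H x (a + b) = act H x a + act H x b"
    and act_act: "x \<in> carrier H \<Longrightarrow> act H (act H x a) b = act H x (a * b)"
    and act_1: "x \<in> carrier H \<Longrightarrow> act H x 1 = x"
    and ip_add_right: "x \<in> carrier H \<Longrightarrow> y \<in> carrier H \<Longrightarrow> z \<in> carrier H \<Longrightarrow>
      ip H x (y + z) = ip H x y + ip H x z"
    and ip_act_right: "x \<in> carrier H \<Longrightarrow> y \<in> carrier H \<Longrightarrow> ip H x (act H y a) = ip H x y * a"
    and ip_star: "x \<in> carrier H \<Longrightarrow> y \<in> carrier H \<Longrightarrow> star (ip H x y) = ip H y x"
    and ip_pos: "x \<in> carrier H \<Longrightarrow> pos_elem (ip H x x)"
    and ip_definite: "x \<in> carrier H \<Longrightarrow> ip H x x = 0 \<Longrightarrow> x = 0"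
begin

lemma act_zero_right: "x \<in> carrier H \<Longrightarrow> act H x 0 = 0"
  using act_add_right[of x 0 0] by simp

lemma act_minus_1: "x \<in> carrier H \<Longrightarrow> act H x (- 1) = - x"
  using act_add_right[of x 1 "- 1"] by (simp add: act_zero_right act_1 eq_neg_iff_add_eq_0 add.commute)

lemma minus_mem: "x \<in> carrier H \<Longrightarrow> - x \<in> carrier H"
  using act_mem[of x "- 1"] by (simp add: act_minus_1)

lemma diff_mem: "x \<in> carrier H \<Longrightarrow> y \<in> carrier H \<Longrightarrow> x - y \<in> carrier H"
  using add_mem[of x "- y"] by (simp add: minus_mem)

lemma sum_mem: "(\<And>i. i \<in> I \<Longrightarrow> f i \<in> carrier H) \<Longrightarrow> sum f I \<in> carrier H"
  by (induction I rule: infinite_finite_induct) (auto simp: zero_mem add_mem)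

lemma act_diff_left:
  "x \<in> carrier H \<Longrightarrow> y \<in> carrier H \<Longrightarrow> act H (x - y) a = act H x a - act H y a"
  using act_add_left[of "x - y" y a] by (simp add: diff_mem)

lemma ip_zero_right: "x \<in> carrier H \<Longrightarrow> ip H x 0 = 0"
  using ip_add_right[of x 0 0] by (simp add: zero_mem)

lemma ip_diff_right:
  "x \<in> carrier H \<Longrightarrow> y \<in> carrier H \<Longrightarrow> z \<in> carrier H \<Longrightarrow> ip H x (y - z) = ip H x y - ip H x z"
  using ip_add_right[of x "y - z" z] by (simp add: diff_mem)

lemma ip_add_left:
  "x \<in> carrier H \<Longrightarrow> y \<in> carrier H \<Longrightarrow> z \<in> carrier H \<Longrightarrow> ip H (y + z) x = ip H y x + ip H z x"
  using arg_cong[OF ip_add_right[of x y z], of star] by (simp add: star_add ip_star add_mem)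

lemma ip_diff_left:
  "x \<in> carrier H \<Longrightarrow> y \<in> carrier H \<Longrightarrow> z \<in> carrier H \<Longrightarrow> ip H (y - z) x = ip H y x - ip H z x"
  using arg_cong[OF ip_diff_right[of x y z], of star] by (simp add: star_diff ip_star diff_mem)

lemma ip_act_left: "x \<in> carrier H \<Longrightarrow> y \<in> carrier H \<Longrightarrow> ip H (act H x a) y = star a * ip H x y"
  using arg_cong[OF ip_act_right[of y x a], of star] by (simp add: star_mult ip_star act_mem)

lemma ip_zero_left: "x \<in> carrier H \<Longrightarrow> ip H 0 x = 0"
  using arg_cong[OF ip_zero_right[of x], of star] by (simp add: ip_star zero_mem)

lemma ip_act_diff:
  assumes "x \<in> carrier H" "y \<in> carrier H"
  shows "ip H (act H x a - y) (act H x a - y) =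
    star a * ip H x x * a - star a * ip H x y - ip H y x * a + ip H y y"
  using assms
  by (simp add: ip_diff_left ip_diff_right ip_act_left ip_act_right act_mem diff_mem algebra_simps)

lemma hnorm_nonneg: "hnorm H x \<ge> 0"
  by (simp add: hnorm_def)

lemma hnorm_square: "(hnorm H x)\<^sup>2 = norm (ip H x x)"
  by (simp add: hnorm_def)

lemma hnorm_zero: "hnorm H 0 = 0"
  by (simp add: hnorm_def ip_zero_right zero_mem)

lemma hnorm_eq_0: "x \<in> carrier H \<Longrightarrow> hnorm H x = 0 \<Longrightarrow> x = 0"
  by (simp add: hnorm_def ip_definite)

lemma Cauchy_Schwarz:
  assumes "x \<in> carrier H" "y \<in> carrier H"
  shows "norm (ip H x y) \<le> hnorm H x * hnorm H y"
proof (rule power2_le_imp_le)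
  have "(norm (ip H x y))\<^sup>2 \<le> norm (ip H x x) * norm (ip H y y)"
  proof (rule norm_square_le_of_pos_elem)
    show "pos_elem (star a * ip H x x * a - star a * ip H x y - star (ip H x y) * a + ip H y y)" for a
      unfolding ip_star[OF assms] ip_act_diff[OF assms, symmetric]
      by (intro ip_pos diff_mem act_mem assms)
  qed (intro ip_pos assms)+
  then show "(norm (ip H x y))\<^sup>2 \<le> (hnorm H x * hnorm H y)\<^sup>2"
    by (simp add: power_mult_distrib hnorm_square)
qed (simp add: hnorm_nonneg)

lemma hnorm_triangle:
  assumes "x \<in> carrier H" "y \<in> carrier H"
  shows "hnorm H (x + y) \<le> hnorm H x + hnorm H y"
proof (rule power2_le_imp_le)
  have "(hnorm H (x + y))\<^sup>2 = norm (ip H x x + ip H x y + ip H y x + ip H y y)"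
    using assms by (simp add: hnorm_square ip_add_left ip_add_right add_mem algebra_simps)
  also have "\<dots> \<le> norm (ip H x x) + norm (ip H x y) + norm (ip H y x) + norm (ip H y y)"
    by (intro norm_triangle_le add_mono order_refl)
  also have "\<dots> \<le> (hnorm H x)\<^sup>2 + hnorm H x * hnorm H y + hnorm H y * hnorm H x + (hnorm H y)\<^sup>2"
    unfolding hnorm_square by (intro add_mono Cauchy_Schwarz order_refl assms)
  also have "\<dots> = (hnorm H x + hnorm H y)\<^sup>2" by (simp add: power2_eq_square algebra_simps)
  finally show "(hnorm H (x + y))\<^sup>2 \<le> (hnorm H x + hnorm H y)\<^sup>2" .
qed (simp add: hnorm_nonneg)

lemma hnorm_act:
  assumes "x \<in> carrier H"
  shows "hnorm H (act H x a) \<le> hnorm H x * norm a"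
proof (rule power2_le_imp_le)
  have "(hnorm H (act H x a))\<^sup>2 = norm (star a * ip H x x * a)"
    using assms by (simp add: hnorm_square ip_act_left ip_act_right act_mem mult.assoc)
  also have "\<dots> \<le> norm (star a) * norm (ip H x x) * norm a"
    by (meson norm_mult_ineq order_trans mult_right_mono norm_ge_zero)
  finally show "(hnorm H (act H x a))\<^sup>2 \<le> (hnorm H x * norm a)\<^sup>2"
    by (simp add: power_mult_distrib hnorm_square[symmetric]) (simp add: power2_eq_square mult.commute mult.left_commute)
qed (simp add: hnorm_nonneg)

lemma hnorm_minus: "x \<in> carrier H \<Longrightarrow> hnorm H (- x) = hnorm H x"
  using hnorm_act[of x "- 1"] hnorm_act[of "- x" "- 1"]
  by (simp add: act_minus_1 minus_mem)

lemma hnorm_diff_commute: "x \<in> carrier H \<Longrightarrow> y \<in> carrier H \<Longrightarrow> hnorm H (x - y) = hnorm H (y - x)"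
  using hnorm_minus[of "x - y"] by (simp add: diff_mem)

lemma hnorm_triangle_diff:
  "x \<in> carrier H \<Longrightarrow> y \<in> carrier H \<Longrightarrow> hnorm H (x - y) \<le> hnorm H x + hnorm H y"
  using hnorm_triangle[of x "- y"] by (simp add: minus_mem hnorm_minus)

lemma eqI_ip:
  assumes "x \<in> carrier H" "y \<in> carrier H" "\<And>z. z \<in> carrier H \<Longrightarrow> ip H z x = ip H z y"
  shows "x = y"
  using ip_definite[of "x - y"] assms by (simp add: diff_mem ip_diff_right)

lemma closed_submodule_zero: "closed_submodule H {0}"
proof -
  have "act H 0 a = 0" for a using act_diff_left[of 0 0 a] by (simp add: zero_mem)
  moreover have "x = 0" if "\<forall>n. s n = 0" "x \<in> carrier H" "(\<lambda>n. hnorm H (s n - x)) \<longlonglongrightarrow> 0"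
    for s :: "nat \<Rightarrow> 'h" and x
    using that by (intro hnorm_eq_0) (auto simp: hnorm_minus LIMSEQ_const_iff)
  ultimately show ?thesis by (auto simp: closed_submodule_def zero_mem)
qed

lemma closed_submodule_carrier: "closed_submodule H (carrier H)"
  by (simp add: closed_submodule_def zero_mem add_mem act_mem)

end

lemma submod_simps [simp]:
  "carrier (submod H M) = M" "act (submod H M) = act H" "ip (submod H M) = ip H"
  "hnorm (submod H M) = hnorm H"
  by (simp_all add: submod_def hnorm_def fun_eq_iff)

lemma closed_submoduleD:
  assumes "closed_submodule H M"
  shows "M \<subseteq> carrier H" "0 \<in> M" "x \<in> M \<Longrightarrow> y \<in> M \<Longrightarrow> x + y \<in> M" "x \<in> M \<Longrightarrow> act H x a \<in> M"
    "(\<And>n. s n \<in> M) \<Longrightarrow> x \<in> carrier H \<Longrightarrow> (\<lambda>n. hnorm H (s n - x)) \<longlonglongrightarrow> 0 \<Longrightarrow> x \<in> M"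
  using assms unfolding closed_submodule_def by blast+

lemma closed_submoduleI:
  assumes "M \<subseteq> carrier H" "0 \<in> M" "\<And>x y. x \<in> M \<Longrightarrow> y \<in> M \<Longrightarrow> x + y \<in> M"
    and "\<And>x a. x \<in> M \<Longrightarrow> act H x a \<in> M"
    and "\<And>s x. (\<And>n. s n \<in> M) \<Longrightarrow> x \<in> carrier H \<Longrightarrow> (\<lambda>n. hnorm H (s n - x)) \<longlonglongrightarrow> 0 \<Longrightarrow> x \<in> M"
  shows "closed_submodule H M"
  unfolding closed_submodule_def using assms by blast

lemma closed_submodule_Int:
  assumes M: "closed_submodule H M" and N: "closed_submodule H N"
  shows "closed_submodule H (M \<inter> N)"
proof (rule closed_submoduleI)
  fix s x assume "\<And>n. s n \<in> M \<inter> N" "x \<in> carrier H" "(\<lambda>n. hnorm H (s n - x)) \<longlonglongrightarrow> 0"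
  then have "x \<in> M" "x \<in> N"
    using closed_submoduleD(5)[OF M, of s x] closed_submoduleD(5)[OF N, of s x] by auto
  then show "x \<in> M \<inter> N" by blast
qed (use closed_submoduleD(1-4)[OF M] closed_submoduleD(2-4)[OF N] in auto)

lemma (in ip_module) ip_module_submod:
  assumes "closed_submodule H M"
  shows "ip_module (submod H M)"
proof -
  note D = closed_submoduleD(2-4)[OF assms]
  note sub = subsetD[OF closed_submoduleD(1)[OF assms]]
  show ?thesis
    unfolding ip_module_def submod_simps
    by (intro conjI allI impI)
      (simp_all add: D sub act_add_left act_add_right act_act act_1 ip_add_right ip_act_right ip_star
        ip_pos ip_definite)
qed

section \<open>Completeness and bounded module maps\<close>

text \<open>The one-sided range m \<le> n gives the usual Cauchy condition in a module, by
  \<open>hnorm_diff_commute\<close>.\<close>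

definition complete_hmodule :: "('a::cstar_algebra, 'h::ab_group_add) hmodule \<Rightarrow> bool" where
  "complete_hmodule H \<longleftrightarrow> (\<forall>s. (\<forall>n. s n \<in> carrier H) \<and>
     (\<forall>e>0. \<exists>N. \<forall>m\<ge>N. \<forall>n\<ge>m. hnorm H (s n - s m) < e) \<longrightarrow>
     (\<exists>x\<in>carrier H. (\<lambda>n. hnorm H (s n - x)) \<longlonglongrightarrow> 0))"

lemma complete_hmodule_submod:
  fixes H :: "('a::cstar_algebra, 'b::ab_group_add) hmodule"
  assumes "complete_hmodule H" "closed_submodule H M"
  shows "complete_hmodule (submod H M)"
  unfolding complete_hmodule_def submod_simps
proof (intro allI impI, elim conjE)
  fix s :: "nat \<Rightarrow> 'b" assume s: "\<forall>n. s n \<in> M" and C: "\<forall>e>0. \<exists>N. \<forall>m\<ge>N. \<forall>n\<ge>m. hnorm H (s n - s m) < e"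
  have "\<forall>n. s n \<in> carrier H" using s closed_submoduleD(1)[OF assms(2)] by auto
  then obtain x where "x \<in> carrier H" "(\<lambda>n. hnorm H (s n - x)) \<longlonglongrightarrow> 0"
    using assms(1) C unfolding complete_hmodule_def by blast
  then show "\<exists>x\<in>M. (\<lambda>n. hnorm H (s n - x)) \<longlonglongrightarrow> 0"
    using closed_submoduleD(5)[OF assms(2)] s by blast
qed

text \<open>Adjoints are left out because many maps composed below are restrictions to
  non-orthogonal summands or inverses of such restrictions, for which only boundedness is at
  hand.\<close>

definition blin :: "('a::cstar_algebra, 'h::ab_group_add) hmodule
    \<Rightarrow> ('a, 'k::ab_group_add) hmodule \<Rightarrow> ('h \<Rightarrow> 'k) \<Rightarrow> bool" where
  "blin H K T \<longleftrightarrow> mod_linear H K T \<and> mod_bounded H K T"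

lemma blinI:
  assumes "\<And>x. x \<in> carrier H \<Longrightarrow> T x \<in> carrier K"
    and "\<And>x y. x \<in> carrier H \<Longrightarrow> y \<in> carrier H \<Longrightarrow> T (x + y) = T x + T y"
    and "\<And>x a. x \<in> carrier H \<Longrightarrow> T (act H x a) = act K (T x) a"
    and "\<And>x. x \<in> carrier H \<Longrightarrow> hnorm K (T x) \<le> B * hnorm H x"
  shows "blin H K T"
  unfolding blin_def mod_linear_def mod_bounded_def using assms by blast

lemma blinD:
  assumes "blin H K T"
  shows "x \<in> carrier H \<Longrightarrow> T x \<in> carrier K"
    and "x \<in> carrier H \<Longrightarrow> y \<in> carrier H \<Longrightarrow> T (x + y) = T x + T y"
    and "x \<in> carrier H \<Longrightarrow> T (act H x a) = act K (T x) a"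
  using assms by (auto simp: blin_def mod_linear_def)

text \<open>The normalisation B \<ge> 1 allows multiplying inequalities by B and dividing by
  it.\<close>

lemma blin_bound:
  assumes "blin H K T"
  obtains B where "B \<ge> 1" "\<And>x. x \<in> carrier H \<Longrightarrow> hnorm K (T x) \<le> B * hnorm H x"
proof -
  obtain B where B: "\<forall>x\<in>carrier H. hnorm K (T x) \<le> B * hnorm H x"
    using assms by (auto simp: blin_def mod_bounded_def)
  have "hnorm K (T x) \<le> max B 1 * hnorm H x" if "x \<in> carrier H" for x
    using B that by (smt (verit) mult_right_mono hnorm_def real_sqrt_ge_zero norm_ge_zero)
  then show thesis by (intro that[of "max B 1"]) auto
qed

lemma blin_diff:
  assumes "ip_module H" "blin H K T" "x \<in> carrier H" "y \<in> carrier H"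
  shows "T (x - y) = T x - T y"
  using blinD(2)[OF assms(2), of "x - y" y] assms ip_module.diff_mem[OF assms(1)] by simp

lemma blin_zero:
  assumes "ip_module H" "blin H K T"
  shows "T 0 = 0"
  using blinD(2)[OF assms(2), of 0 0] ip_module.zero_mem[OF assms(1)] by simp

lemma blin_compose:
  assumes "blin H K T" "blin K L U"
  shows "blin H L (\<lambda>x. U (T x))"
proof -
  obtain B where B: "B \<ge> 1" "\<And>x. x \<in> carrier H \<Longrightarrow> hnorm K (T x) \<le> B * hnorm H x"
    using blin_bound[OF assms(1)] by blast
  obtain C where C: "C \<ge> 1" "\<And>x. x \<in> carrier K \<Longrightarrow> hnorm L (U x) \<le> C * hnorm K x"
    using blin_bound[OF assms(2)] by blast
  show ?thesis
  proof (rule blinI[where B = "C * B"])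
    fix x assume x: "x \<in> carrier H"
    have "hnorm L (U (T x)) \<le> C * hnorm K (T x)" using C blinD[OF assms(1)] x by auto
    also have "\<dots> \<le> C * (B * hnorm H x)" using B C x by (intro mult_left_mono) auto
    finally show "hnorm L (U (T x)) \<le> C * B * hnorm H x" by simp
  qed (auto simp: blinD[OF assms(1)] blinD[OF assms(2)])
qed

lemma blin_add:
  assumes "ip_module K" "blin H K T" "blin H K U"
  shows "blin H K (\<lambda>x. T x + U x)"
proof -
  interpret K: ip_module K by fact
  obtain B where B: "\<And>x. x \<in> carrier H \<Longrightarrow> hnorm K (T x) \<le> B * hnorm H x"
    using blin_bound[OF assms(2)] by blast
  obtain C where C: "\<And>x. x \<in> carrier H \<Longrightarrow> hnorm K (U x) \<le> C * hnorm H x"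
    using blin_bound[OF assms(3)] by blast
  show ?thesis
  proof (rule blinI[where B = "B + C"])
    fix x assume x: "x \<in> carrier H"
    have "hnorm K (T x + U x) \<le> hnorm K (T x) + hnorm K (U x)"
      using blinD(1)[OF assms(2)] blinD(1)[OF assms(3)] x by (intro K.hnorm_triangle) auto
    then show "hnorm K (T x + U x) \<le> (B + C) * hnorm H x"
      using B[OF x] C[OF x] by (simp add: distrib_right)
  qed (auto simp: blinD[OF assms(2)] blinD[OF assms(3)] K.add_mem K.act_add_left)
qed

lemma blin_diff_fun:
  assumes "ip_module K" "blin H K T" "blin H K U"
  shows "blin H K (\<lambda>x. T x - U x)"
proof -
  interpret K: ip_module K by fact
  have "blin K K (\<lambda>x. - x)"
  proof (rule blinI[where B = 1])
    show "- act K x a = act K (- x) a" if "x \<in> carrier K" for x a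
      using K.act_diff_left[of x x a] K.act_add_left[of x "- x" a] that
      by (simp add: K.minus_mem minus_unique)
  qed (auto simp: K.minus_mem K.hnorm_minus)
  from blin_add[OF assms(1,2) blin_compose[OF assms(3) this]] show ?thesis by simp
qed

lemma blin_id: "blin H H (\<lambda>x. x)"
  by (rule blinI[where B = 1]) auto

lemma blin_zero_fun:
  assumes "ip_module K" "ip_module H"
  shows "blin H K (\<lambda>x. 0)"
proof -
  interpret K: ip_module K by fact
  interpret H: ip_module H by fact
  show ?thesis
    using closed_submoduleD(4)[OF K.closed_submodule_zero, of 0]
    by (intro blinI[where B = 0]) (auto simp: K.zero_mem K.hnorm_zero)
qed

lemma blin_superset: "blin H (submod K N) T \<Longrightarrow> N \<subseteq> carrier K \<Longrightarrow> blin H K T"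
  by (auto simp: blin_def mod_linear_def mod_bounded_def)

lemma blin_subset:
  assumes "blin H K T" "M \<subseteq> carrier H" "T ` M \<subseteq> N"
  shows "blin (submod H M) (submod K N) T"
proof -
  obtain B where "\<And>x. x \<in> carrier H \<Longrightarrow> hnorm K (T x) \<le> B * hnorm H x"
    using blin_bound[OF assms(1)] by blast
  then show ?thesis
    using assms(2,3) blinD[OF assms(1)] by (intro blinI[where B = B]) (auto simp: subset_iff)
qed

text \<open>The source of closedness for the tilted summands: each is cut out by a bounded map with
  values in a closed submodule, kernels being the case N = {0}.\<close>

lemma closed_submodule_vimage:
  assumes "ip_module H" "ip_module K" "blin H K T" "closed_submodule K N"
  shows "closed_submodule H {x \<in> carrier H. T x \<in> N}"
proof -
  interpret H: ip_module H by fact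
  interpret K: ip_module K by fact
  note D = closed_submoduleD(2-4)[OF assms(4)] and T = blinD[OF assms(3)]
  obtain B where B: "B \<ge> 1" "\<And>x. x \<in> carrier H \<Longrightarrow> hnorm K (T x) \<le> B * hnorm H x"
    using blin_bound[OF assms(3)] by blast
  show ?thesis
  proof (rule closed_submoduleI)
    fix s x
    assume s: "\<And>n. s n \<in> {x \<in> carrier H. T x \<in> N}" and x: "x \<in> carrier H"
      and lim: "(\<lambda>n. hnorm H (s n - x)) \<longlonglongrightarrow> 0"
    have "(\<lambda>n. hnorm K (T (s n) - T x)) \<longlonglongrightarrow> 0"
    proof (rule tendsto_sandwich[OF _ _ tendsto_const])
      show "\<forall>\<^sub>F n in sequentially. hnorm K (T (s n) - T x) \<le> B * hnorm H (s n - x)"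
        using B s x by (auto simp: blin_diff[OF assms(1,3), symmetric] H.diff_mem)
      show "(\<lambda>n. B * hnorm H (s n - x)) \<longlonglongrightarrow> 0"
        using tendsto_mult_right_zero[OF lim] by simp
    qed (simp add: K.hnorm_nonneg)
    then have "T x \<in> N"
      using closed_submoduleD(5)[OF assms(4), of "\<lambda>n. T (s n)"] s x T(1) by auto
    then show "x \<in> {x \<in> carrier H. T x \<in> N}" using x by simp
  qed (auto simp: T D H.zero_mem H.add_mem H.act_mem blin_zero[OF assms(1,3)])
qed

text \<open>Adjointability provides a bare function S. It is linear because inner products separate
  points, and bounded because the square of the norm of S y is the norm of the product of T (S y)
  with y.\<close>

lemma blin_adjoint:
  assumes "ip_module H" "ip_module K" "blin H K T" "S ` carrier K \<subseteq> carrier H"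
    and adj: "\<And>x y. x \<in> carrier H \<Longrightarrow> y \<in> carrier K \<Longrightarrow> ip K (T x) y = ip H x (S y)"
  shows "blin K H S"
proof -
  interpret H: ip_module H by fact
  interpret K: ip_module K by fact
  have S: "S y \<in> carrier H" if "y \<in> carrier K" for y using assms(4) that by auto
  note T = blinD[OF assms(3)]
  obtain B where B: "B \<ge> 1" "\<And>x. x \<in> carrier H \<Longrightarrow> hnorm K (T x) \<le> B * hnorm H x"
    using blin_bound[OF assms(3)] by blast
  show ?thesis
  proof (rule blinI[where B = B])
    show "S (x + y) = S x + S y" if "x \<in> carrier K" "y \<in> carrier K" for x y
      using that by (intro H.eqI_ip)
        (auto simp: S H.add_mem K.add_mem H.ip_add_right adj[symmetric] K.ip_add_right T)
    show "S (act K x a) = act H (S x) a" if "x \<in> carrier K" for x a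
      using that by (intro H.eqI_ip)
        (auto simp: S H.act_mem K.act_mem H.ip_act_right adj[symmetric] K.ip_act_right T)
    show "hnorm H (S y) \<le> B * hnorm K y" if y: "y \<in> carrier K" for y
    proof (cases "hnorm H (S y) = 0")
      case True
      then show ?thesis using B(1) by (simp add: K.hnorm_nonneg)
    next
      case False
      have "(hnorm H (S y))\<^sup>2 = norm (ip K (T (S y)) y)" by (simp add: H.hnorm_square adj S y)
      also have "\<dots> \<le> hnorm K (T (S y)) * hnorm K y" by (intro K.Cauchy_Schwarz T S y)
      also have "\<dots> \<le> B * hnorm H (S y) * hnorm K y"
        by (intro mult_right_mono B S y K.hnorm_nonneg)
      finally show ?thesis
        using False H.hnorm_nonneg[of "S y"] by (simp add: power2_eq_square)
    qed
  qed (use S in auto)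
qed

text \<open>Replacing \<open>x\<close> by \<open>x d\<close> upgrades a norm inequality between linear maps to an inequality of
  algebra-valued inner products.\<close>

lemma pos_elem_ip_diff:
  assumes "ip_module K" "ip_module L" "blin H K T" "blin H L U"
    and act: "\<And>x a. x \<in> carrier H \<Longrightarrow> act H x a \<in> carrier H"
    and le: "\<And>x. x \<in> carrier H \<Longrightarrow> hnorm L (U x) \<le> c * hnorm K (T x)" and x: "x \<in> carrier H"
  shows "pos_elem (c\<^sup>2 *\<^sub>R ip K (T x) (T x) - ip L (U x) (U x))"
proof -
  interpret K: ip_module K by fact
  interpret L: ip_module L by fact
  note T = blinD[OF assms(3)] and U = blinD[OF assms(4)]
  show ?thesis
  proof (rule pos_elem_diff_of_norm_le)
    fix d
    have "norm (star d * ip L (U x) (U x) * d) = (hnorm L (U (act H x d)))\<^sup>2"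
      by (simp add: L.hnorm_square U x L.ip_act_left L.ip_act_right L.act_mem mult.assoc)
    also have "\<dots> \<le> (c * hnorm K (T (act H x d)))\<^sup>2"
      using le act x by (intro power_mono) (auto simp: L.hnorm_nonneg)
    also have "\<dots> = norm (c\<^sup>2 *\<^sub>R (star d * ip K (T x) (T x) * d))"
      by (simp add: power_mult_distrib K.hnorm_square T x K.ip_act_left K.ip_act_right K.act_mem mult.assoc)
    finally show "norm (star d * ip L (U x) (U x) * d) \<le> norm (star d * c\<^sup>2 *\<^sub>R ip K (T x) (T x) * d)"
      by simp
  qed (intro pos_elem_scaleR K.ip_pos L.ip_pos T U x zero_le_power2)+
qed

text \<open>With \<open>1 \<le> c\<close>, \<open>1 \<le> B\<close> and \<open>\<parallel>x\<parallel> / c \<le> \<parallel>T x\<parallel> \<le> B \<parallel>x\<parallel>\<close>, the operator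
  \<open>V = 1 - T\<^sup>* T / B\<^sup>2\<close> is positive and at most \<open>\<kappa> = 1 - 1 / (B c)\<^sup>2 < 1\<close>. So \<open>V\<close> is a
  contraction and \<open>T\<^sup>* T\<close> is inverted by a Neumann series.\<close>

lemma adjoint_mult_self_surj:
  assumes "ip_module H" "ip_module K" "complete_hmodule H" "blin H K T" "blin K H S"
    and adj: "\<And>x y. x \<in> carrier H \<Longrightarrow> y \<in> carrier K \<Longrightarrow> ip K (T x) y = ip H x (S y)"
    and below: "\<And>x. x \<in> carrier H \<Longrightarrow> hnorm H x \<le> c * hnorm K (T x)" and c: "c \<ge> 1"
    and y: "y \<in> carrier H"
  shows "\<exists>x\<in>carrier H. S (T x) = y"
proof -
  interpret H: ip_module H by fact
  interpret K: ip_module K by fact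
  note T = blinD[OF assms(4)] and S = blinD[OF assms(5)]
  obtain B where B: "B \<ge> 1" "\<And>x. x \<in> carrier H \<Longrightarrow> hnorm K (T x) \<le> B * hnorm H x"
    using blin_bound[OF assms(4)] by blast
  define \<alpha> where "\<alpha> = 1 / B\<^sup>2"
  have \<alpha>: "\<alpha> > 0" "\<alpha> \<le> 1" using B(1) by (auto simp: \<alpha>_def)
  define \<kappa> where "\<kappa> = 1 - \<alpha> / c\<^sup>2"
  have "c\<^sup>2 \<ge> 1" using c by simp
  then have \<kappa>: "\<kappa> \<ge> 0" "\<kappa> < 1" using \<alpha> c by (auto simp: \<kappa>_def divide_simps intro: order_trans)
  define V where "V x = x - act H (S (T x)) (of_real \<alpha>)" for x
  have ST: "S (T x) \<in> carrier H" if "x \<in> carrier H" for x using S T that by auto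
  have Vm: "V x \<in> carrier H" if "x \<in> carrier H" for x
    using that by (simp add: V_def H.diff_mem H.act_mem ST)
  have ipV: "ip H x (V z) = ip H x z - \<alpha> *\<^sub>R ip K (T x) (T z)" if "x \<in> carrier H" "z \<in> carrier H" for x z
    using that by (simp add: V_def H.ip_diff_right H.ip_act_right ST H.act_mem adj[symmetric] T of_real_def)
  have posV: "pos_elem (ip H x (V x))" if x: "x \<in> carrier H" for x
  proof -
    have "pos_elem (B\<^sup>2 *\<^sub>R ip H x x - ip K (T x) (T x))"
      using pos_elem_ip_diff[OF assms(1,2) blin_id assms(4) H.act_mem B(2) x] by simp
    then have "pos_elem (\<alpha> *\<^sub>R (B\<^sup>2 *\<^sub>R ip H x x - ip K (T x) (T x)))"
      using \<alpha> by (intro pos_elem_scaleR) auto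
    then show ?thesis using B(1) by (simp add: ipV x scaleR_right_diff_distrib \<alpha>_def)
  qed
  have leV: "norm (ip H x (V x)) \<le> \<kappa> * (hnorm H x)\<^sup>2" if x: "x \<in> carrier H" for x
  proof -
    have "pos_elem (c\<^sup>2 *\<^sub>R ip K (T x) (T x) - ip H x x)"
      using pos_elem_ip_diff[OF assms(2,1,4) blin_id H.act_mem below x] by simp
    then have "pos_elem ((\<alpha> / c\<^sup>2) *\<^sub>R (c\<^sup>2 *\<^sub>R ip K (T x) (T x) - ip H x x))"
      using \<alpha> by (intro pos_elem_scaleR) auto
    then have "pos_elem (\<kappa> *\<^sub>R ip H x x - ip H x (V x))"
      using c by (simp add: ipV x scaleR_right_diff_distrib scaleR_left_diff_distrib \<kappa>_def)
    from pos_elem_norm_mono[OF posV[OF x] this] show ?thesis using \<kappa> by (simp add: H.hnorm_square)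
  qed
  \<comment> \<open>\<open>leV\<close> bounds only the form of V. Cauchy-Schwarz for the
    semidefinite form \<open>ip H x (V z)\<close>, taken at x = V z, turns this into a bound for V
    itself.\<close>
  have nV: "hnorm H (V z) \<le> \<kappa> * hnorm H z" if z: "z \<in> carrier H" for z
  proof (cases "hnorm H (V z) = 0")
    case True
    then show ?thesis using \<kappa> by (simp add: H.hnorm_nonneg)
  next
    case False
    then have pos: "hnorm H (V z) > 0" using H.hnorm_nonneg[of "V z"] by linarith
    define x where "x = V z"
    have x: "x \<in> carrier H" using Vm z by (simp add: x_def)
    have sym: "star (ip H x (V z)) = ip H z (V x)"
      by (simp add: ipV x z star_diff star_scaleR H.ip_star K.ip_star T)
    have "(norm (ip H x (V z)))\<^sup>2 \<le> norm (ip H x (V x)) * norm (ip H z (V z))"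
    proof (rule norm_square_le_of_pos_elem)
      fix a
      let ?w = "act H x a - z"
      have Tw: "T ?w = act K (T x) a - T z"
        using x z by (simp add: blin_diff[OF assms(1,4)] H.act_mem T)
      have "ip H ?w (V ?w) = ip H ?w ?w - \<alpha> *\<^sub>R ip K (T ?w) (T ?w)"
        using x z by (intro ipV H.diff_mem H.act_mem)
      also have "\<dots> = star a * ip H x (V x) * a - star a * ip H x (V z) - ip H z (V x) * a + ip H z (V z)"
        unfolding Tw using x z
        by (simp add: H.ip_act_diff K.ip_act_diff T ipV algebra_simps)
      finally show "pos_elem (star a * ip H x (V x) * a - star a * ip H x (V z)
          - star (ip H x (V z)) * a + ip H z (V z))"
        unfolding sym using posV[of ?w] x z by (simp add: H.diff_mem H.act_mem)
    qed (intro posV x z)+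
    also have "\<dots> \<le> (\<kappa> * (hnorm H x)\<^sup>2) * (\<kappa> * (hnorm H z)\<^sup>2)"
      using \<kappa> by (intro mult_mono leV x z) auto
    finally have "((hnorm H (V z))\<^sup>2)\<^sup>2 \<le> (hnorm H (V z) * (\<kappa> * hnorm H z))\<^sup>2"
      unfolding x_def H.hnorm_square[symmetric] by (simp add: power2_eq_square ac_simps)
    then have "(hnorm H (V z))\<^sup>2 \<le> hnorm H (V z) * (\<kappa> * hnorm H z)"
      by (rule power2_le_imp_le) (simp add: \<kappa> H.hnorm_nonneg)
    then show ?thesis using pos by (simp add: power2_eq_square)
  qed
  have Vdiff: "V (x - z) = V x - V z" if "x \<in> carrier H" "z \<in> carrier H" for x z
    using that by (simp add: V_def blin_diff[OF assms(1,4)] blin_diff[OF assms(2,5)] T ST H.act_diff_left)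
  have Vadd: "V (x + z) = V x + V z" if "x \<in> carrier H" "z \<in> carrier H" for x z
    using Vdiff[of "x + z" z] that by (simp add: H.add_mem)
  have V0: "V 0 = 0" using Vadd[of 0 0] by (simp add: H.zero_mem)
  \<comment> \<open>S (T x) = y amounts to x - V x = \<alpha> y, so the Neumann series of V is
    applied to \<alpha> y.\<close>
  define z where "z = act H y (of_real \<alpha>)"
  have z: "z \<in> carrier H" by (simp add: z_def H.act_mem y)
  define w where "w k = (V ^^ k) z" for k
  have w0: "w 0 = z" and wS: "w (Suc k) = V (w k)" for k by (simp_all add: w_def)
  have wm: "w k \<in> carrier H" for k by (induction k) (auto simp: w0 wS z Vm)
  have nw: "hnorm H (w k) \<le> \<kappa> ^ k * hnorm H z" for k
  proof (induction k)
    case (Suc k)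
    have "hnorm H (w (Suc k)) \<le> \<kappa> * hnorm H (w k)" by (simp add: wS nV wm)
    also have "\<dots> \<le> \<kappa> * (\<kappa> ^ k * hnorm H z)" using Suc \<kappa> by (intro mult_left_mono) auto
    finally show ?case by simp
  qed (simp add: w0)
  define X where "X n = (\<Sum>k<n. w k)" for n
  have XS: "X (Suc n) = X n + w n" for n by (simp add: X_def)
  have Xm: "X n \<in> carrier H" for n unfolding X_def by (intro H.sum_mem wm)
  have XV: "X n - V (X n) = z - w n" for n
  proof (induction n)
    case 0
    then show ?case by (simp add: X_def V0 w0)
  next
    case (Suc n)
    have "X (Suc n) - V (X (Suc n)) = (X n - V (X n)) + (w n - w (Suc n))"
      by (simp add: XS Vadd Xm wm wS)
    then show ?case by (simp add: Suc)
  qed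
  have Xd: "hnorm H (X (n + k) - X n) \<le> (\<kappa> ^ n - \<kappa> ^ (n + k)) / (1 - \<kappa>) * hnorm H z" for n k
  proof (induction k)
    case 0
    then show ?case by (simp add: H.hnorm_zero)
  next
    case (Suc k)
    have "X (n + Suc k) - X n = (X (n + k) - X n) + w (n + k)" by (simp add: XS)
    then have "hnorm H (X (n + Suc k) - X n) \<le> hnorm H (X (n + k) - X n) + hnorm H (w (n + k))"
      by (simp only:) (intro H.hnorm_triangle H.diff_mem Xm wm)
    also have "\<dots> \<le> (\<kappa> ^ n - \<kappa> ^ (n + k)) / (1 - \<kappa>) * hnorm H z + \<kappa> ^ (n + k) * hnorm H z"
      by (intro add_mono Suc nw)
    also have "\<dots> = (\<kappa> ^ n - \<kappa> ^ (n + Suc k)) / (1 - \<kappa>) * hnorm H z"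
      using \<kappa> by (simp add: field_simps)
    finally show ?case .
  qed
  define M where "M = hnorm H z / (1 - \<kappa>)"
  have M: "M \<ge> 0" using \<kappa> H.hnorm_nonneg by (simp add: M_def)
  have \<kappa>lim: "(\<lambda>n. \<kappa> ^ n) \<longlonglongrightarrow> 0" using \<kappa> by (intro LIMSEQ_realpow_zero) auto
  have "\<exists>x\<in>carrier H. (\<lambda>n. hnorm H (X n - x)) \<longlonglongrightarrow> 0"
  proof (rule assms(3)[unfolded complete_hmodule_def, rule_format], intro conjI allI impI)
    fix e :: real assume "e > 0"
    have "(\<lambda>n. \<kappa> ^ n * M) \<longlonglongrightarrow> 0" using tendsto_mult_left_zero[OF \<kappa>lim] by simp
    then have "\<forall>\<^sub>F n in sequentially. \<kappa> ^ n * M < e" using \<open>e > 0\<close> by (rule order_tendstoD)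
    then obtain N where N: "\<And>n. n \<ge> N \<Longrightarrow> \<kappa> ^ n * M < e" by (auto simp: eventually_sequentially)
    have "hnorm H (X n - X m) < e" if "m \<ge> N" "n \<ge> m" for m n
    proof -
      have "hnorm H (X n - X m) \<le> (\<kappa> ^ m - \<kappa> ^ n) * M" using Xd[of m "n - m"] that by (simp add: M_def)
      also have "\<dots> \<le> \<kappa> ^ m * M" using \<kappa> M by (intro mult_right_mono) auto
      also have "\<dots> < e" using N that by simp
      finally show ?thesis .
    qed
    then show "\<exists>N. \<forall>m\<ge>N. \<forall>n\<ge>m. hnorm H (X n - X m) < e" by blast
  qed (rule Xm)
  then obtain x where x: "x \<in> carrier H" and lim: "(\<lambda>n. hnorm H (X n - x)) \<longlonglongrightarrow> 0" by blast
  \<comment> \<open>The left side does not depend on n; replacing x by the partial sum X n, which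
    solves the equation up to w n, makes the right side tend to 0.\<close>
  have bound: "hnorm H ((x - V x) - z) \<le> 2 * hnorm H (X n - x) + \<kappa> ^ n * hnorm H z" for n
  proof -
    let ?u = "X n - x"
    have u: "?u \<in> carrier H" by (intro H.diff_mem Xm x)
    have eq: "(x - V x) - z = (V ?u - ?u) - w n" using XV[of n] by (simp add: Vdiff Xm x algebra_simps)
    have "hnorm H ((x - V x) - z) \<le> hnorm H (V ?u) + hnorm H ?u + hnorm H (w n)"
      unfolding eq using H.hnorm_triangle_diff[of "V ?u - ?u" "w n"] H.hnorm_triangle_diff[of "V ?u" ?u]
      by (simp add: u Vm H.diff_mem wm)
    moreover have "hnorm H (V ?u) \<le> 1 * hnorm H ?u"
      using nV[OF u] \<kappa> H.hnorm_nonneg by (meson less_imp_le mult_right_mono order_trans)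
    ultimately show ?thesis using nw[of n] by simp
  qed
  have "(\<lambda>n. 2 * hnorm H (X n - x) + \<kappa> ^ n * hnorm H z) \<longlonglongrightarrow> 2 * 0 + 0 * hnorm H z"
    by (intro tendsto_intros lim \<kappa>lim)
  then have "hnorm H ((x - V x) - z) \<le> 0" using bound by (intro LIMSEQ_le_const) auto
  then have "hnorm H ((x - V x) - z) = 0" using H.hnorm_nonneg by (intro antisym)
  then have "(x - V x) - z = 0" using x z by (intro H.hnorm_eq_0 H.diff_mem Vm)
  then have eq: "act H (S (T x)) (of_real \<alpha>) = act H y (of_real \<alpha>)" by (simp add: V_def z_def)
  have *: "act H (act H v (of_real \<alpha>)) (of_real (1 / \<alpha>)) = v" if "v \<in> carrier H" for v
  proof -
    have "(of_real \<alpha> :: 'a) * of_real (1 / \<alpha>) = 1" unfolding of_real_mult[symmetric] using \<alpha> by simp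
    then show ?thesis using that by (simp only: H.act_act H.act_1)
  qed
  have "S (T x) = y" using *[OF ST[OF x]] unfolding eq *[OF y] by (rule sym)
  then show ?thesis using x by blast
qed

text \<open>Bounding the square of the norm of T x by Cauchy-Schwarz for x and S (T x) shows that S
  T is bounded below by 1 / c^2. Hence preimages are unique, so choosing them is linear, with bound
  c^2.\<close>

lemma adjoint_mult_self_inverse:
  assumes "ip_module H" "ip_module K" "complete_hmodule H" "blin H K T" "blin K H S"
    and adj: "\<And>x y. x \<in> carrier H \<Longrightarrow> y \<in> carrier K \<Longrightarrow> ip K (T x) y = ip H x (S y)"
    and below: "\<And>x. x \<in> carrier H \<Longrightarrow> hnorm H x \<le> c * hnorm K (T x)" and c: "c \<ge> 1"
  obtains R where "blin H H R" "\<And>y. y \<in> carrier H \<Longrightarrow> S (T (R y)) = y"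
proof -
  interpret H: ip_module H by fact
  interpret K: ip_module K by fact
  note T = blinD[OF assms(4)] and S = blinD[OF assms(5)]
  have "\<forall>y\<in>carrier H. \<exists>x\<in>carrier H. S (T x) = y" using adjoint_mult_self_surj[OF assms] by blast
  then obtain R where R: "\<And>y. y \<in> carrier H \<Longrightarrow> R y \<in> carrier H"
    "\<And>y. y \<in> carrier H \<Longrightarrow> S (T (R y)) = y" by metis
  have lower: "hnorm H x \<le> c\<^sup>2 * hnorm H (S (T x))" if x: "x \<in> carrier H" for x
  proof (cases "hnorm H x = 0")
    case True
    then show ?thesis by (simp add: H.hnorm_nonneg)
  next
    case False
    then have pos: "hnorm H x > 0" using H.hnorm_nonneg[of x] by linarith
    have "(hnorm H x)\<^sup>2 \<le> (c * hnorm K (T x))\<^sup>2" by (intro power_mono below x H.hnorm_nonneg)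
    also have "\<dots> = c\<^sup>2 * norm (ip H x (S (T x)))"
      by (simp add: power_mult_distrib K.hnorm_square adj T x)
    also have "\<dots> \<le> c\<^sup>2 * (hnorm H x * hnorm H (S (T x)))"
      by (intro mult_left_mono H.Cauchy_Schwarz x S T) auto
    finally have "hnorm H x * hnorm H x \<le> hnorm H x * (c\<^sup>2 * hnorm H (S (T x)))"
      by (simp add: power2_eq_square ac_simps)
    then show ?thesis using pos by simp
  qed
  have inj: "x = x'" if "x \<in> carrier H" "x' \<in> carrier H" "S (T x) = S (T x')" for x x'
  proof -
    have "hnorm H (x - x') \<le> c\<^sup>2 * hnorm H (S (T (x - x')))" by (intro lower H.diff_mem that)
    also have "S (T (x - x')) = 0"
      using that by (simp add: blin_diff[OF assms(1,4)] blin_diff[OF assms(2,5)] T)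
    finally have "hnorm H (x - x') = 0" using H.hnorm_nonneg[of "x - x'"] by (simp add: H.hnorm_zero)
    then show ?thesis using H.hnorm_eq_0[of "x - x'"] that by (simp add: H.diff_mem)
  qed
  have "blin H H R"
  proof (rule blinI[where B = "c\<^sup>2"])
    show "R (x + y) = R x + R y" if "x \<in> carrier H" "y \<in> carrier H" for x y
      using that by (rule_tac inj) (auto simp: R H.add_mem T S)
    show "R (act H x a) = act H (R x) a" if "x \<in> carrier H" for x a
      using that by (rule_tac inj) (auto simp: R H.act_mem T S)
    show "hnorm H (R x) \<le> c\<^sup>2 * hnorm H x" if "x \<in> carrier H" for x
      using lower[of "R x"] that by (simp add: R)
  qed (rule R)
  then show thesis using that R by blast
qed

section \<open>The standard module and orthogonal sums\<close>

text \<open>Stated for finite sums because it is used to show that \<open>ell2\<close> is a module,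
  before the inequality of the locale is available.\<close>

lemma Cauchy_Schwarz_sum:
  fixes x y :: "'i \<Rightarrow> 'a::cstar_algebra"
  shows "(norm (\<Sum>k\<in>I. star (x k) * y k))\<^sup>2
    \<le> norm (\<Sum>k\<in>I. star (x k) * x k) * norm (\<Sum>k\<in>I. star (y k) * y k)"
proof (rule norm_square_le_of_pos_elem)
  fix a :: 'a
  have "pos_elem (\<Sum>k\<in>I. star (x k * a - y k) * (x k * a - y k))"
    by (intro pos_elem_sum pos_elem_star_mult)
  also have "(\<Sum>k\<in>I. star (x k * a - y k) * (x k * a - y k)) =
      star a * (\<Sum>k\<in>I. star (x k) * x k) * a - star a * (\<Sum>k\<in>I. star (x k) * y k)
      - star (\<Sum>k\<in>I. star (x k) * y k) * a + (\<Sum>k\<in>I. star (y k) * y k)"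
    by (simp add: star_diff star_mult star_star star_sum sum_distrib_left sum_distrib_right
        sum_subtractf sum.distrib algebra_simps)
  finally show "pos_elem (star a * (\<Sum>k\<in>I. star (x k) * x k) * a
      - star a * (\<Sum>k\<in>I. star (x k) * y k)
      - star (\<Sum>k\<in>I. star (x k) * y k) * a + (\<Sum>k\<in>I. star (y k) * y k))" .
qed (intro pos_elem_sum pos_elem_star_mult)+

lemma ell2_simps [simp]:
  "x \<in> carrier ell2 \<longleftrightarrow> summable (\<lambda>k. star (x k) * x k)"
  "act ell2 x a = (\<lambda>k. x k * a)" "ip ell2 x y = (\<Sum>k. star (x k) * y k)"
  by (simp_all add: ell2_def)

text \<open>The norms of the terms need not be summable, so comparison fails; instead the finite
  Cauchy-Schwarz inequality is applied to blocks of terms.\<close>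

lemma summable_ip_ell2:
  fixes x y :: "nat \<Rightarrow> 'a::cstar_algebra"
  assumes x: "summable (\<lambda>k. star (x k) * x k)" and y: "summable (\<lambda>k. star (y k) * y k)"
  shows "summable (\<lambda>k. star (x k) * y k)"
  unfolding summable_Cauchy
proof (intro allI impI)
  fix e :: real assume e: "e > 0"
  obtain N1 where N1: "\<And>m n. m \<ge> N1 \<Longrightarrow> norm (\<Sum>k=m..<n. star (x k) * x k) < e"
    using x e unfolding summable_Cauchy by blast
  obtain N2 where N2: "\<And>m n. m \<ge> N2 \<Longrightarrow> norm (\<Sum>k=m..<n. star (y k) * y k) < e"
    using y e unfolding summable_Cauchy by blast
  have "norm (\<Sum>k=m..<n. star (x k) * y k) < e" if m: "m \<ge> max N1 N2" for m n
  proof -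
    have "(norm (\<Sum>k=m..<n. star (x k) * y k))\<^sup>2
        \<le> norm (\<Sum>k=m..<n. star (x k) * x k) * norm (\<Sum>k=m..<n. star (y k) * y k)"
      by (rule Cauchy_Schwarz_sum)
    also have "\<dots> < e * e" using N1[of m n] N2[of m n] m e by (intro mult_strict_mono) auto
    finally show ?thesis using e by (simp add: power2_eq_square[symmetric] power2_less_imp_less)
  qed
  then show "\<exists>N. \<forall>m\<ge>N. \<forall>n. norm (\<Sum>k=m..<n. star (x k) * y k) < e" by blast
qed

lemma pos_elem_suminf:
  assumes "summable f" "\<And>k. pos_elem (f k)"
  shows "pos_elem (suminf f)"
  by (rule pos_elem_lim[OF summable_LIMSEQ[OF assms(1)]]) (intro pos_elem_sum assms)

lemma pos_elem_suminf_diff: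
  fixes f :: "nat \<Rightarrow> 'a::cstar_algebra"
  assumes f: "summable f" "\<And>k. pos_elem (f k)" and I: "finite I"
  shows "pos_elem (suminf f - sum f I)"
proof -
  define g where "g k = (if k \<in> I then f k else 0)" for k
  have g: "g sums sum f I" unfolding g_def using I by (rule sums_If_finite_set)
  have "pos_elem (\<Sum>k. f k - g k)"
    using f by (intro pos_elem_suminf summable_diff sums_summable[OF g]) (auto simp: g_def)
  then show ?thesis using suminf_diff[OF f(1) sums_summable[OF g]] sums_unique[OF g] by simp
qed

lemma norm_sum_le_suminf:
  fixes f :: "nat \<Rightarrow> 'a::cstar_algebra"
  assumes f: "summable f" "\<And>k. pos_elem (f k)" and I: "finite I"
  shows "norm (sum f I) \<le> norm (suminf f)"
  using pos_elem_norm_mono[OF pos_elem_sum[of I f] pos_elem_suminf_diff[OF assms]] f(2) by simp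

lemma ip_module_ell2: "ip_module (ell2 :: ('a::cstar_algebra, nat \<Rightarrow> 'a) hmodule)"
proof
  fix x y z :: "nat \<Rightarrow> 'a" and a b :: 'a
  show "0 \<in> carrier (ell2 :: ('a, nat \<Rightarrow> 'a) hmodule)" by simp
  show "act ell2 (x + y) a = act ell2 x a + act ell2 y a"
    "act ell2 x (a + b) = act ell2 x a + act ell2 x b"
    "act ell2 (act ell2 x a) b = act ell2 x (a * b)" "act ell2 x 1 = x"
    by (auto simp: algebra_simps fun_eq_iff)
  assume x: "x \<in> carrier ell2"
  have "(\<lambda>k. star (x k * a) * (x k * a)) = (\<lambda>k. star a * ((star (x k) * x k) * a))"
    by (simp add: star_mult mult.assoc)
  then show "act ell2 x a \<in> carrier ell2"
    using summable_mult[OF summable_mult2] x by (simp only: ell2_simps)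
  show "pos_elem (ip ell2 x x)"
    unfolding ell2_simps using x by (intro pos_elem_suminf) (auto simp: pos_elem_star_mult)
  show "x = 0" if "ip ell2 x x = 0"
  proof
    fix k
    have "norm (sum (\<lambda>k. star (x k) * x k) {k}) \<le> norm (\<Sum>k. star (x k) * x k)"
      using x by (intro norm_sum_le_suminf) (auto simp: pos_elem_star_mult)
    then show "x k = 0 k" using that by (simp add: norm_star_mult)
  qed
  assume y: "y \<in> carrier ell2"
  note xy = summable_ip_ell2[of x y] summable_ip_ell2[of y x]
  have "summable (\<lambda>k. (star (x k) * x k + star (x k) * y k) + (star (y k) * x k + star (y k) * y k))"
    using x y xy by (intro summable_add) auto
  then show "x + y \<in> carrier ell2" by (simp add: star_add algebra_simps)
  show "ip ell2 x (act ell2 y a) = ip ell2 x y * a"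
    using suminf_mult2[OF xy(1), of a] x y by (simp add: mult.assoc)
  show "star (ip ell2 x y) = ip ell2 y x"
    using bounded_linear.suminf[OF bounded_linear_star xy(1)] x y by (simp add: star_mult star_star)
  assume z: "z \<in> carrier ell2"
  show "ip ell2 x (y + z) = ip ell2 x y + ip ell2 x z"
    using suminf_add[OF xy(1) summable_ip_ell2[of x z]] x y z by (simp add: distrib_left)
qed

lemma norm_sum_le_hnorm_ell2:
  assumes "x \<in> carrier ell2" "finite I"
  shows "norm (\<Sum>k\<in>I. star (x k) * x k) \<le> (hnorm ell2 x)\<^sup>2"
  using norm_sum_le_suminf[of "\<lambda>k. star (x k) * x k" I] assms
  by (simp add: hnorm_def pos_elem_star_mult)

text \<open>The triangle inequality on finitely many coordinates, for sequences not yet known to lie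
  in \<open>ell2\<close>.\<close>

lemma norm_sum_square_triangle:
  fixes x y :: "'i \<Rightarrow> 'a::cstar_algebra"
  assumes "norm (\<Sum>k\<in>I. star (x k) * x k) \<le> r\<^sup>2" "norm (\<Sum>k\<in>I. star (y k) * y k) \<le> t\<^sup>2"
    "r \<ge> 0" "t \<ge> 0"
  shows "norm (\<Sum>k\<in>I. star (x k + y k) * (x k + y k)) \<le> (r + t)\<^sup>2"
proof -
  let ?s = "\<lambda>u v. \<Sum>k\<in>I. star (u k) * v k"
  have cs: "norm (?s u v) \<le> r * t" if "{u, v} = {x, y}" for u v
  proof (rule power2_le_imp_le)
    have "(norm (?s u v))\<^sup>2 \<le> norm (?s u u) * norm (?s v v)" by (rule Cauchy_Schwarz_sum)
    also have "\<dots> = norm (?s x x) * norm (?s y y)" using that by (auto simp: doubleton_eq_iff)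
    also have "\<dots> \<le> r\<^sup>2 * t\<^sup>2" by (intro mult_mono assms) auto
    finally show "(norm (?s u v))\<^sup>2 \<le> (r * t)\<^sup>2" by (simp add: power_mult_distrib)
  qed (use assms in auto)
  have "norm (\<Sum>k\<in>I. star (x k + y k) * (x k + y k)) = norm (?s x x + ?s x y + ?s y x + ?s y y)"
    by (simp add: star_add sum.distrib algebra_simps)
  also have "\<dots> \<le> norm (?s x x) + norm (?s x y) + norm (?s y x) + norm (?s y y)"
    by (intro norm_triangle_le add_mono order_refl)
  also have "\<dots> \<le> r\<^sup>2 + r * t + r * t + t\<^sup>2" by (intro add_mono assms cs) auto
  finally show ?thesis by (simp add: power2_eq_square algebra_simps)
qed

text \<open>The limit is built coordinatewise, and its \<open>hnorm\<close> means nothing until it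
  is known to be square-summable. So the estimates are made on finite index sets, with bounds
  independent of the set.\<close>

lemma complete_ell2: "complete_hmodule (ell2 :: ('a::cstar_algebra, nat \<Rightarrow> 'a) hmodule)"
  unfolding complete_hmodule_def
proof (intro allI impI, elim conjE)
  interpret ip_module "ell2 :: ('a, nat \<Rightarrow> 'a) hmodule" by (rule ip_module_ell2)
  fix s :: "nat \<Rightarrow> nat \<Rightarrow> 'a"
  assume "\<forall>n. s n \<in> carrier ell2" and C: "\<forall>e>0. \<exists>N. \<forall>m\<ge>N. \<forall>n\<ge>m. hnorm ell2 (s n - s m) < e"
  then have s: "s n \<in> carrier ell2" for n by blast
  have "Cauchy (\<lambda>n. s n k)" for k
  proof (rule metric_CauchyI)
    fix e :: real assume "e > 0"
    then obtain N where N: "\<And>m n. m \<ge> N \<Longrightarrow> n \<ge> m \<Longrightarrow> hnorm ell2 (s n - s m) < e" using C by blast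
    have *: "dist (s m k) (s n k) < e" if "m \<ge> N" "n \<ge> m" for m n
    proof -
      have "(norm (s n k - s m k))\<^sup>2 \<le> (hnorm ell2 (s n - s m))\<^sup>2"
        using norm_sum_le_hnorm_ell2[OF diff_mem[OF s[of n] s[of m]], of "{k}"]
        by (simp add: norm_star_mult)
      then have "norm (s n k - s m k) \<le> hnorm ell2 (s n - s m)"
        by (rule power2_le_imp_le) (rule hnorm_nonneg)
      then show ?thesis using N[OF that] by (simp add: dist_norm norm_minus_commute)
    qed
    show "\<exists>M. \<forall>m\<ge>M. \<forall>n\<ge>M. dist (s m k) (s n k) < e"
      by (rule exI[of _ N]) (metis * dist_commute nle_le)
  qed
  then have "\<exists>l. (\<lambda>n. s n k) \<longlonglongrightarrow> l" for k
    using Cauchy_convergent_iff convergent_def by blast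
  then obtain x where x: "\<And>k. (\<lambda>n. s n k) \<longlonglongrightarrow> x k" by metis
  have close: "norm (\<Sum>k\<in>I. star (s m k - x k) * (s m k - x k)) \<le> e\<^sup>2"
    if N: "\<And>m n. m \<ge> N \<Longrightarrow> n \<ge> m \<Longrightarrow> hnorm ell2 (s n - s m) < e" and m: "m \<ge> N" and I: "finite I"
    for N m e and I :: "nat set"
  proof (rule LIMSEQ_le_const2)
    show "(\<lambda>n. norm (\<Sum>k\<in>I. star (s m k - s n k) * (s m k - s n k)))
        \<longlonglongrightarrow> norm (\<Sum>k\<in>I. star (s m k - x k) * (s m k - x k))"
      by (intro tendsto_intros x)
    have "norm (\<Sum>k\<in>I. star (s m k - s n k) * (s m k - s n k)) \<le> e\<^sup>2" if "n \<ge> m" for n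
    proof -
      have "norm (\<Sum>k\<in>I. star (s m k - s n k) * (s m k - s n k)) \<le> (hnorm ell2 (s m - s n))\<^sup>2"
        using norm_sum_le_hnorm_ell2[OF diff_mem[OF s[of m] s[of n]] I] by simp
      also have "\<dots> = (hnorm ell2 (s n - s m))\<^sup>2" using hnorm_diff_commute[OF s s] by simp
      also have "\<dots> \<le> e\<^sup>2"
        using N[OF m that] by (intro power_mono hnorm_nonneg) simp
      finally show ?thesis .
    qed
    then show "\<exists>N. \<forall>n\<ge>N. norm (\<Sum>k\<in>I. star (s m k - s n k) * (s m k - s n k)) \<le> e\<^sup>2" by blast
  qed
  have "summable (\<lambda>k. star (x k) * x k)"
    unfolding summable_Cauchy
  proof (intro allI impI)
    fix e :: real assume e: "e > 0"
    \<comment> \<open>A block of x is split into a block of s N and one of x - s N, each of size at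
      most r; and (2 r)^2 = 4 e / 9 < e.\<close>
    define r where "r = sqrt e / 3"
    have r: "r > 0" "(2 * r)\<^sup>2 < e" using e by (simp_all add: r_def power_divide power_mult_distrib)
    obtain N where N: "\<And>m n. m \<ge> N \<Longrightarrow> n \<ge> m \<Longrightarrow> hnorm ell2 (s n - s m) < r" using C r(1) by blast
    obtain L where L: "\<And>m n. m \<ge> L \<Longrightarrow> norm (\<Sum>k=m..<n. star (s N k) * s N k) < r\<^sup>2"
      using s[of N] r(1) unfolding ell2_simps summable_Cauchy by (meson zero_less_power)
    have "norm (\<Sum>k=m..<n. star (x k) * x k) < e" if m: "m \<ge> L" for m n
    proof -
      have "star (x k - s N k) * (x k - s N k) = star (s N k - x k) * (s N k - x k)" for k
        by (simp add: star_diff algebra_simps)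
      moreover have "norm (\<Sum>k=m..<n. star (s N k - x k) * (s N k - x k)) \<le> r\<^sup>2"
        by (rule close[of N]) (use N in auto)
      ultimately have "norm (\<Sum>k=m..<n. star (x k - s N k) * (x k - s N k)) \<le> r\<^sup>2"
        by presburger
      then have "norm (\<Sum>k=m..<n. star (s N k + (x k - s N k)) * (s N k + (x k - s N k))) \<le> (r + r)\<^sup>2"
        using L[OF m, of n] r(1) by (intro norm_sum_square_triangle) auto
      then have "norm (\<Sum>k=m..<n. star (x k) * x k) \<le> (2 * r)\<^sup>2"
        unfolding mult_2 by simp
      then show ?thesis using r(2) by linarith
    qed
    then show "\<exists>N. \<forall>m\<ge>N. \<forall>n. norm (\<Sum>k=m..<n. star (x k) * x k) < e" by blast
  qed
  then have xc: "x \<in> carrier ell2" by simp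
  have "(\<lambda>n. hnorm ell2 (s n - x)) \<longlonglongrightarrow> 0"
  proof (rule LIMSEQ_I)
    fix e :: real assume e: "e > 0"
    then obtain N where N: "\<And>m n. m \<ge> N \<Longrightarrow> n \<ge> m \<Longrightarrow> hnorm ell2 (s n - s m) < e / 2"
      using C by (meson half_gt_zero)
    have "hnorm ell2 (s n - x) \<le> e / 2" if n: "n \<ge> N" for n
    proof (rule power2_le_imp_le)
      have "summable (\<lambda>k. star (s n k - x k) * (s n k - x k))"
        using diff_mem[OF s[of n] xc] by simp
      then have "(\<lambda>L. norm (\<Sum>k<L. star (s n k - x k) * (s n k - x k)))
          \<longlonglongrightarrow> norm (\<Sum>k. star (s n k - x k) * (s n k - x k))"
        by (intro tendsto_norm summable_LIMSEQ)
      then have "norm (\<Sum>k. star (s n k - x k) * (s n k - x k)) \<le> (e / 2)\<^sup>2"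
        by (rule LIMSEQ_le_const2) (use close[OF N n] in blast)
      then show "(hnorm ell2 (s n - x))\<^sup>2 \<le> (e / 2)\<^sup>2" by (simp add: hnorm_square)
    qed (use e in simp)
    then show "\<exists>no. \<forall>n\<ge>no. norm (hnorm ell2 (s n - x) - 0) < e"
      using e hnorm_nonneg by (intro exI[of _ N]) (auto intro: order_le_less_trans[of _ "e / 2"])
  qed
  then show "\<exists>x\<in>carrier ell2. (\<lambda>n. hnorm ell2 (s n - x)) \<longlonglongrightarrow> 0" using xc by blast
qed

section \<open>Orthogonal sums of two modules\<close>

lemma hsum_simps [simp]:
  "carrier (H \<oplus>\<^sub>H K) = carrier H \<times> carrier K"
  "act (H \<oplus>\<^sub>H K) (x, y) a = (act H x a, act K y a)"
  "ip (H \<oplus>\<^sub>H K) (x, y) (x', y') = ip H x x' + ip K y y'"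
  by (simp_all add: hsum_def)

context
  fixes H :: "('a::cstar_algebra, 'h::ab_group_add) hmodule"
    and K :: "('a, 'k::ab_group_add) hmodule"
  assumes H: "ip_module H" and K: "ip_module K"
begin

interpretation H: ip_module H by (rule H)
interpretation K: ip_module K by (rule K)

lemma ip_module_hsum: "ip_module (H \<oplus>\<^sub>H K)"
  unfolding ip_module_def
proof (intro conjI allI impI)
  fix p assume "p \<in> carrier (H \<oplus>\<^sub>H K)" "ip (H \<oplus>\<^sub>H K) p p = 0"
  then obtain x y where p: "p = (x, y)" and xy: "x \<in> carrier H" "y \<in> carrier K"
    and s: "ip H x x + ip K y y = 0"
    by (cases p) auto
  \<comment> \<open>Each positive summand is dominated in norm by the sum, which is 0.\<close>
  have "ip H x x = 0" "ip K y y = 0"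
    using pos_elem_norm_mono[of "ip H x x" "ip K y y"] pos_elem_norm_mono[of "ip K y y" "ip H x x"]
      xy s by (simp_all add: H.ip_pos K.ip_pos add.commute)
  then show "p = 0" using H.ip_definite K.ip_definite xy by (simp add: p zero_prod_def)
qed (auto simp: zero_prod_def H.zero_mem K.zero_mem H.add_mem K.add_mem H.act_mem K.act_mem
    H.act_add_left K.act_add_left H.act_add_right K.act_add_right H.act_act K.act_act H.act_1 K.act_1
    H.ip_add_right K.ip_add_right H.ip_act_right K.ip_act_right star_add H.ip_star K.ip_star
    distrib_right intro!: pos_elem_add H.ip_pos K.ip_pos)

lemma hnorm_fst_le:
  assumes "x \<in> carrier H" "y \<in> carrier K"
  shows "hnorm H x \<le> hnorm (H \<oplus>\<^sub>H K) (x, y)"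
  using pos_elem_norm_mono[OF H.ip_pos[OF assms(1)] K.ip_pos[OF assms(2)]] by (simp add: hnorm_def)

lemma hnorm_snd_le:
  assumes "x \<in> carrier H" "y \<in> carrier K"
  shows "hnorm K y \<le> hnorm (H \<oplus>\<^sub>H K) (x, y)"
  using pos_elem_norm_mono[OF K.ip_pos[OF assms(2)] H.ip_pos[OF assms(1)]]
  by (simp add: hnorm_def add.commute)

lemma hnorm_hsum_le:
  assumes "x \<in> carrier H" "y \<in> carrier K"
  shows "hnorm (H \<oplus>\<^sub>H K) (x, y) \<le> hnorm H x + hnorm K y"
proof (rule power2_le_imp_le)
  have "(hnorm (H \<oplus>\<^sub>H K) (x, y))\<^sup>2 \<le> (hnorm H x)\<^sup>2 + (hnorm K y)\<^sup>2"
    by (simp add: hnorm_def norm_triangle_ineq)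
  also have "\<dots> \<le> (hnorm H x + hnorm K y)\<^sup>2"
    using H.hnorm_nonneg[of x] K.hnorm_nonneg[of y] by (simp add: power2_sum)
  finally show "(hnorm (H \<oplus>\<^sub>H K) (x, y))\<^sup>2 \<le> (hnorm H x + hnorm K y)\<^sup>2" .
qed (simp add: H.hnorm_nonneg K.hnorm_nonneg)

lemma blin_fst: "blin (H \<oplus>\<^sub>H K) H fst"
  by (rule blinI[where B = 1]) (auto simp: hnorm_fst_le)

lemma blin_snd: "blin (H \<oplus>\<^sub>H K) K snd"
  by (rule blinI[where B = 1]) (auto simp: hnorm_snd_le)

lemma blin_Pair:
  assumes T: "blin L H T" and U: "blin L K U"
  shows "blin L (H \<oplus>\<^sub>H K) (\<lambda>x. (T x, U x))"
proof -
  obtain B where B: "B \<ge> 1" "\<And>x. x \<in> carrier L \<Longrightarrow> hnorm H (T x) \<le> B * hnorm L x"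
    using blin_bound[OF T] by blast
  obtain C where C: "C \<ge> 1" "\<And>x. x \<in> carrier L \<Longrightarrow> hnorm K (U x) \<le> C * hnorm L x"
    using blin_bound[OF U] by blast
  show ?thesis
  proof (rule blinI[where B = "B + C"])
    fix x assume x: "x \<in> carrier L"
    have "hnorm (H \<oplus>\<^sub>H K) (T x, U x) \<le> hnorm H (T x) + hnorm K (U x)"
      by (intro hnorm_hsum_le blinD(1)[OF T] blinD(1)[OF U] x)
    then show "hnorm (H \<oplus>\<^sub>H K) (T x, U x) \<le> (B + C) * hnorm L x"
      using B(2)[OF x] C(2)[OF x] by (simp add: distrib_right)
  qed (auto simp: blinD[OF T] blinD[OF U])
qed

lemma closed_submodule_Times:
  assumes "closed_submodule H M" "closed_submodule K N"
  shows "closed_submodule (H \<oplus>\<^sub>H K) (M \<times> N)"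
proof -
  have "M \<times> N = {p \<in> carrier (H \<oplus>\<^sub>H K). fst p \<in> M} \<inter> {p \<in> carrier (H \<oplus>\<^sub>H K). snd p \<in> N}"
    using closed_submoduleD(1)[OF assms(1)] closed_submoduleD(1)[OF assms(2)] by auto
  then show ?thesis
    using closed_submodule_Int[OF closed_submodule_vimage[OF ip_module_hsum H blin_fst assms(1)]
        closed_submodule_vimage[OF ip_module_hsum K blin_snd assms(2)]] by simp
qed

end

section \<open>Triangular operator matrices\<close>

lemma BaI:
  assumes "blin H K T" "\<And>y. y \<in> carrier K \<Longrightarrow> S y \<in> carrier H"
    and "\<And>x y. x \<in> carrier H \<Longrightarrow> y \<in> carrier K \<Longrightarrow> ip K (T x) y = ip H x (S y)"
  shows "T \<in> Ba H K"
  using assms unfolding Ba_def blin_def adjointable_def by blast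

lemma BaE:
  assumes "T \<in> Ba H K"
  obtains S where "blin H K T" "\<And>y. y \<in> carrier K \<Longrightarrow> S y \<in> carrier H"
    "\<And>x y. x \<in> carrier H \<Longrightarrow> y \<in> carrier K \<Longrightarrow> ip K (T x) y = ip H x (S y)"
  using assms unfolding Ba_def blin_def adjointable_def by blast

lemma mod_isoI:
  assumes "blin H K T" "blin K H J"
    and "\<And>x. x \<in> carrier H \<Longrightarrow> J (T x) = x" "\<And>y. y \<in> carrier K \<Longrightarrow> T (J y) = y"
  shows "mod_iso H K T"
proof -
  have bij: "bij_betw T (carrier H) (carrier K)"
    using assms blinD(1)[OF assms(1)] blinD(1)[OF assms(2)] by (intro bij_betw_byWitness[of _ J]) auto
  have "inv_into (carrier H) T y = J y" if "y \<in> carrier K" for y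
    using bij that assms(4) blinD(1)[OF assms(2)]
    by (metis bij_betw_inv_into_left)
  then have "mod_bounded K H (inv_into (carrier H) T)"
    using assms(2) by (auto simp: blin_def mod_bounded_def)
  then show ?thesis using bij assms(1) by (simp add: mod_iso_def blin_def)
qed

lemma mod_isoE:
  assumes "mod_iso H K T" "ip_module H"
  obtains J where "blin H K T" "blin K H J" "\<And>x. x \<in> carrier H \<Longrightarrow> J (T x) = x"
    "\<And>y. y \<in> carrier K \<Longrightarrow> T (J y) = y"
proof -
  interpret H: ip_module H by fact
  define J where "J = inv_into (carrier H) T"
  have T: "blin H K T" and bij: "bij_betw T (carrier H) (carrier K)" and bd: "mod_bounded K H J"
    using assms(1) by (auto simp: mod_iso_def blin_def J_def)
  have JT: "J (T x) = x" if "x \<in> carrier H" for x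
    using bij that unfolding J_def by (rule bij_betw_inv_into_left)
  have TJ: "T (J y) = y" if "y \<in> carrier K" for y
    using bij that unfolding J_def by (rule bij_betw_inv_into_right)
  have Jm: "J y \<in> carrier H" if "y \<in> carrier K" for y
    using bij that unfolding J_def by (metis bij_betwE bij_betw_inv_into)
  obtain B where B: "\<And>y. y \<in> carrier K \<Longrightarrow> hnorm H (J y) \<le> B * hnorm K y"
    using bd unfolding mod_bounded_def by blast
  have "blin K H J"
  proof (rule blinI[OF Jm _ _ B])
    fix x y a assume x: "x \<in> carrier K"
    show "J (act K x a) = act H (J x) a"
      using JT[of "act H (J x) a"] x by (simp add: H.act_mem Jm blinD[OF T] TJ)
    assume y: "y \<in> carrier K"
    show "J (x + y) = J x + J y"
      using JT[of "J x + J y"] x y by (simp add: H.add_mem Jm blinD[OF T] TJ)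
  qed
  then show thesis using that T JT TJ by blast
qed

lemma direct_sum_hsum:
  assumes "ip_module H" "ip_module K" and M: "direct_sum H M N" and M': "direct_sum K M' N'"
  shows "direct_sum (H \<oplus>\<^sub>H K) (M \<times> M') (N \<times> N')"
  unfolding direct_sum_def
proof (intro conjI)
  show "closed_submodule (H \<oplus>\<^sub>H K) (M \<times> M')" "closed_submodule (H \<oplus>\<^sub>H K) (N \<times> N')"
    using assms by (auto simp: direct_sum_def intro: closed_submodule_Times)
  have "carrier H = {m + n |m n. m \<in> M \<and> n \<in> N}" "carrier K = {m + n |m n. m \<in> M' \<and> n \<in> N'}"
    using M M' by (auto simp: direct_sum_def)
  then show "carrier (H \<oplus>\<^sub>H K) = {m + n |m n. m \<in> M \<times> M' \<and> n \<in> N \<times> N'}"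
    by (fastforce simp: plus_prod_def)
  show "M \<times> M' \<inter> N \<times> N' = {0}"
    using M M' by (auto simp: direct_sum_def zero_prod_def Times_Int_Times)
qed

lemma fin_gen_hsum:
  assumes "ip_module H" "ip_module K" and M: "closed_submodule H M" "fin_gen (submod H M)"
    and N: "closed_submodule K N" "fin_gen (submod K N)"
  shows "fin_gen (submod (H \<oplus>\<^sub>H K) (M \<times> N))"
proof -
  interpret M: ip_module "submod H M" by (rule ip_module.ip_module_submod[OF assms(1) M(1)])
  interpret N: ip_module "submod K N" by (rule ip_module.ip_module_submod[OF assms(2) N(1)])
  have MN: "ip_module (submod (H \<oplus>\<^sub>H K) (M \<times> N))"
    using assms by (intro ip_module.ip_module_submod ip_module_hsum closed_submodule_Times)
  interpret MN: ip_module "submod (H \<oplus>\<^sub>H K) (M \<times> N)" by (rule MN)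
  obtain S where S: "finite S" "S \<subseteq> M" "M = {\<Sum>s\<in>S. act H s (a s) | a. True}"
    using M(2) by (auto simp: fin_gen_def)
  obtain S' where S': "finite S'" "S' \<subseteq> N" "N = {\<Sum>s\<in>S'. act K s (a s) | a. True}"
    using N(2) by (auto simp: fin_gen_def)
  have H0: "act H 0 a = 0" for a using M.act_diff_left[of 0 0 a] M.zero_mem by simp
  have K0: "act K 0 a = 0" for a using N.act_diff_left[of 0 0 a] N.zero_mem by simp
  \<comment> \<open>Without the generator 0 the two families are disjoint, and the test
    \<open>snd p = 0\<close> tells them apart; this lets one coefficient function serve both. A
    generator 0 contributes nothing to a sum.\<close>
  define A where "A = (\<lambda>s. (s, 0::'c)) ` (S - {0})"
  define B where "B = (\<lambda>s. (0::'b, s)) ` (S' - {0})"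
  have fin: "finite A" "finite B" and disj: "A \<inter> B = {}" using S(1) S'(1) by (auto simp: A_def B_def)
  have sub: "A \<union> B \<subseteq> M \<times> N" using S(2) S'(2) M.zero_mem N.zero_mem by (auto simp: A_def B_def)
  have "\<exists>c. (m, n) = (\<Sum>p\<in>A \<union> B. act (H \<oplus>\<^sub>H K) p (c p))" if m: "m \<in> M" and n: "n \<in> N" for m n
  proof -
    obtain a where a: "m = (\<Sum>s\<in>S. act H s (a s))" using m S(3) by blast
    obtain b where b: "n = (\<Sum>s\<in>S'. act K s (b s))" using n S'(3) by blast
    define c where "c = (\<lambda>p. if snd p = 0 then a (fst p) else b (snd p))"
    have "(\<Sum>p\<in>A. act (H \<oplus>\<^sub>H K) p (c p)) = (\<Sum>s\<in>S - {0}. (act H s (a s), 0))"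
      unfolding A_def by (subst sum.reindex) (auto simp: inj_on_def c_def K0)
    also have "\<dots> = (m, 0)"
      using sum.remove[OF S(1), of 0 "\<lambda>s. act H s (a s)"]
      by (cases "0 \<in> S") (auto simp: a H0 prod_eq_iff fst_sum snd_sum)
    finally have 1: "(\<Sum>p\<in>A. act (H \<oplus>\<^sub>H K) p (c p)) = (m, 0)" .
    have "(\<Sum>p\<in>B. act (H \<oplus>\<^sub>H K) p (c p)) = (\<Sum>s\<in>S' - {0}. (0, act K s (b s)))"
      unfolding B_def by (subst sum.reindex) (auto simp: inj_on_def c_def H0)
    also have "\<dots> = (0, n)"
      using sum.remove[OF S'(1), of 0 "\<lambda>s. act K s (b s)"]
      by (cases "0 \<in> S'") (auto simp: b K0 prod_eq_iff fst_sum snd_sum)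
    finally have "(\<Sum>p\<in>A \<union> B. act (H \<oplus>\<^sub>H K) p (c p)) = (m, n)"
      using 1 fin disj by (simp add: sum.union_disjoint)
    then show ?thesis by metis
  qed
  then have "M \<times> N \<subseteq> {\<Sum>p\<in>A \<union> B. act (H \<oplus>\<^sub>H K) p (c p) | c. True}" by fastforce
  moreover have "(\<Sum>p\<in>A \<union> B. act (H \<oplus>\<^sub>H K) p (c p)) \<in> M \<times> N" for c
    using MN.sum_mem[of "A \<union> B" "\<lambda>p. act (H \<oplus>\<^sub>H K) p (c p)"] MN.act_mem sub
    unfolding submod_simps by blast
  ultimately have "M \<times> N = {\<Sum>p\<in>A \<union> B. act (H \<oplus>\<^sub>H K) p (c p) | c. True}" by blast
  then show ?thesis
    unfolding fin_gen_def submod_simps using fin sub by (intro exI[of _ "A \<union> B"]) blast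
qed

lemma upper_triangular_apply [simp]: "upper_triangular F C D (x, y) = (F x + C y, D y)"
  by (simp add: upper_triangular_def)

lemma upper_triangular_Ba:
  assumes "ip_module H" "ip_module K" "F \<in> Ba H H" "C \<in> Ba K H" "D \<in> Ba K K"
  shows "upper_triangular F C D \<in> Ba (H \<oplus>\<^sub>H K) (H \<oplus>\<^sub>H K)"
proof -
  interpret H: ip_module H by fact
  interpret K: ip_module K by fact
  obtain F' where F: "blin H H F" "\<And>y. y \<in> carrier H \<Longrightarrow> F' y \<in> carrier H"
    "\<And>x y. x \<in> carrier H \<Longrightarrow> y \<in> carrier H \<Longrightarrow> ip H (F x) y = ip H x (F' y)"
    using BaE[OF assms(3)] by metis
  obtain C' where C: "blin K H C" "\<And>y. y \<in> carrier H \<Longrightarrow> C' y \<in> carrier K"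
    "\<And>x y. x \<in> carrier K \<Longrightarrow> y \<in> carrier H \<Longrightarrow> ip H (C x) y = ip K x (C' y)"
    using BaE[OF assms(4)] by metis
  obtain D' where D: "blin K K D" "\<And>y. y \<in> carrier K \<Longrightarrow> D' y \<in> carrier K"
    "\<And>x y. x \<in> carrier K \<Longrightarrow> y \<in> carrier K \<Longrightarrow> ip K (D x) y = ip K x (D' y)"
    using BaE[OF assms(5)] by metis
  have eq: "upper_triangular F C D = (\<lambda>p. (F (fst p) + C (snd p), D (snd p)))"
    by (auto simp: upper_triangular_def)
  have "blin (H \<oplus>\<^sub>H K) (H \<oplus>\<^sub>H K) (upper_triangular F C D)"
    unfolding eq using assms(1,2) F(1) C(1) D(1)
    by (intro blin_Pair blin_add blin_compose[OF blin_fst F(1)] blin_compose[OF blin_snd C(1)]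
        blin_compose[OF blin_snd D(1)])
  then show ?thesis
  \<comment> \<open>The adjoint of the matrix is its lower triangular conjugate transpose.\<close>
  proof (rule BaI[where S = "\<lambda>p. (F' (fst p), C' (fst p) + D' (snd p))"])
    fix p q assume "p \<in> carrier (H \<oplus>\<^sub>H K)" "q \<in> carrier (H \<oplus>\<^sub>H K)"
    then show "ip (H \<oplus>\<^sub>H K) (upper_triangular F C D p) q =
        ip (H \<oplus>\<^sub>H K) p (F' (fst q), C' (fst q) + D' (snd q))"
      by (auto simp: H.ip_add_left K.ip_add_right F C D blinD(1)[OF F(1)] blinD(1)[OF C(1)] add.assoc)
  qed (auto simp: F C D K.add_mem)
qed

lemma zero_fun_Ba:
  assumes "ip_module H" "ip_module K"
  shows "(\<lambda>x. 0) \<in> Ba H K"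
  by (rule BaI[OF blin_zero_fun[OF assms(2,1)], where S = "\<lambda>x. 0"])
    (simp_all add: assms ip_module.ip_zero_left ip_module.ip_zero_right ip_module.zero_mem)

lemma MPhi_minus_diagonal:
  assumes "ip_module H" "ip_module K" "F \<in> MPhi_minus H" "D \<in> MPhi_minus K"
  shows "upper_triangular F (\<lambda>x. 0) D \<in> MPhi_minus (H \<oplus>\<^sub>H K)"
proof -
  obtain M1 N1 M2 N2 where F: "F \<in> Ba H H" "diagonal_wrt H F M1 N1 M2 N2"
    "mod_iso (submod H M1) (submod H M2) F" "fin_gen (submod H N2)"
    using assms(3) by (auto simp: MPhi_minus_def)
  obtain M1' N1' M2' N2' where D: "D \<in> Ba K K" "diagonal_wrt K D M1' N1' M2' N2'"
    "mod_iso (submod K M1') (submod K M2') D" "fin_gen (submod K N2')"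
    using assms(4) by (auto simp: MPhi_minus_def)
  let ?T = "upper_triangular F (\<lambda>x. 0) D"
  note dF = F(2)[unfolded diagonal_wrt_def] and dD = D(2)[unfolded diagonal_wrt_def]
  have cl: "closed_submodule H M1" "closed_submodule H M2" "closed_submodule H N2"
    "closed_submodule K M1'" "closed_submodule K M2'" "closed_submodule K N2'"
    using dF dD by (auto simp: direct_sum_def)
  have HK: "ip_module (H \<oplus>\<^sub>H K)" by (rule ip_module_hsum[OF assms(1,2)])
  have TB: "?T \<in> Ba (H \<oplus>\<^sub>H K) (H \<oplus>\<^sub>H K)"
    by (intro upper_triangular_Ba zero_fun_Ba assms F D)
  have sm: "submod (H \<oplus>\<^sub>H K) (M \<times> N) = submod H M \<oplus>\<^sub>H submod K N" for M N
    by (simp add: submod_def hsum_def)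
  note ipM = ip_module.ip_module_submod[OF assms(1)] ip_module.ip_module_submod[OF assms(2)]
  have ip: "ip_module (submod H M1)" "ip_module (submod H M2)"
    "ip_module (submod K M1')" "ip_module (submod K M2')"
    using ipM cl by auto
  obtain J where J: "blin (submod H M1) (submod H M2) F" "blin (submod H M2) (submod H M1) J"
    "\<And>x. x \<in> M1 \<Longrightarrow> J (F x) = x" "\<And>y. y \<in> M2 \<Longrightarrow> F (J y) = y"
    using mod_isoE[OF F(3) ip(1)] by auto
  obtain L where L: "blin (submod K M1') (submod K M2') D" "blin (submod K M2') (submod K M1') L"
    "\<And>x. x \<in> M1' \<Longrightarrow> L (D x) = x" "\<And>y. y \<in> M2' \<Longrightarrow> D (L y) = y"
    using mod_isoE[OF D(3) ip(3)] by auto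
  have eq: "?T = (\<lambda>p. (F (fst p), D (snd p)))" by (auto simp: upper_triangular_def)
  have "mod_iso (submod H M1 \<oplus>\<^sub>H submod K M1') (submod H M2 \<oplus>\<^sub>H submod K M2') ?T"
  proof (rule mod_isoI[where J = "\<lambda>p. (J (fst p), L (snd p))"])
    show "blin (submod H M1 \<oplus>\<^sub>H submod K M1') (submod H M2 \<oplus>\<^sub>H submod K M2') ?T"
      unfolding eq using ip
      by (intro blin_Pair blin_compose[OF blin_fst J(1)] blin_compose[OF blin_snd L(1)])
    show "blin (submod H M2 \<oplus>\<^sub>H submod K M2') (submod H M1 \<oplus>\<^sub>H submod K M1')
        (\<lambda>p. (J (fst p), L (snd p)))"
      using ip by (intro blin_Pair blin_compose[OF blin_fst J(2)] blin_compose[OF blin_snd L(2)])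
  qed (auto simp: J L)
  moreover have "diagonal_wrt (H \<oplus>\<^sub>H K) ?T (M1 \<times> M1') (N1 \<times> N1') (M2 \<times> M2') (N2 \<times> N2')"
    unfolding diagonal_wrt_def
    using dF dD by (auto intro!: direct_sum_hsum assms)
  moreover have "fin_gen (submod (H \<oplus>\<^sub>H K) (N2 \<times> N2'))"
    by (intro fin_gen_hsum assms cl F D)
  ultimately show ?thesis
    unfolding MPhi_minus_def using TB sm by (intro CollectI conjI exI[of _ "M1 \<times> M1'"]
        exI[of _ "N1 \<times> N1'"] exI[of _ "M2 \<times> M2'"] exI[of _ "N2 \<times> N2'"]) simp_all
qed

section \<open>Orthogonal projections and the embedding case\<close>

text \<open>A closed submodule need not be orthogonally complemented, hence the hypothesis. P x is
  the only element of N with the same inner products against N as x, which yields linearity. P is a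
  contraction because the inner squares of x and P x differ by that of x - P x.\<close>

lemma orth_projection:
  assumes "ip_module H" and ds: "direct_sum H (orth_compl H N) N"
  obtains P where "blin H (submod H N) P" "\<And>x. x \<in> carrier H \<Longrightarrow> x - P x \<in> orth_compl H N"
    "\<And>x. x \<in> N \<Longrightarrow> P x = x" "\<And>x. x \<in> orth_compl H N \<Longrightarrow> P x = 0"
    "\<And>x y. x \<in> carrier H \<Longrightarrow> y \<in> carrier H \<Longrightarrow> ip H (P x) y = ip H x (P y)"
proof -
  interpret H: ip_module H by fact
  have N: "closed_submodule H N" and sum: "carrier H = {m + n |m n. m \<in> orth_compl H N \<and> n \<in> N}"
    using ds by (auto simp: direct_sum_def)
  interpret N: ip_module "submod H N" by (rule H.ip_module_submod[OF N])
  note Ns = subsetD[OF closed_submoduleD(1)[OF N]]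
  note Nm = N.add_mem[unfolded submod_simps] N.act_mem[unfolded submod_simps]
    N.diff_mem[unfolded submod_simps] N.zero_mem[unfolded submod_simps]
  have "\<exists>n\<in>N. x - n \<in> orth_compl H N" if x: "x \<in> carrier H" for x
  proof -
    obtain m n where "x = m + n" "m \<in> orth_compl H N" "n \<in> N" using x sum by blast
    then show ?thesis by (intro bexI[of _ n]) auto
  qed
  then obtain P where P: "\<And>x. x \<in> carrier H \<Longrightarrow> P x \<in> N"
    "\<And>x. x \<in> carrier H \<Longrightarrow> x - P x \<in> orth_compl H N" by metis
  have PH: "P x \<in> carrier H" if "x \<in> carrier H" for x using P(1)[OF that] Ns by blast
  have ipP: "ip H n (P x) = ip H n x" if "x \<in> carrier H" "n \<in> N" for x n
  proof -
    have "ip H n (x - P x) = 0" using P(2)[OF that(1)] that(2) by (simp add: orth_compl_def)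
    then show ?thesis using H.ip_diff_right[OF Ns[OF that(2)] that(1) PH[OF that(1)]] by simp
  qed
  have uniq: "P x = n" if x: "x \<in> carrier H" and n: "n \<in> N" and eq: "\<And>k. k \<in> N \<Longrightarrow> ip H k n = ip H k x"
    for x n
    using N.eqI_ip[of "P x" n] P(1)[OF x] n eq ipP[OF x] by simp
  have sym: "ip H (P x) y = ip H x (P y)" if "x \<in> carrier H" "y \<in> carrier H" for x y
  proof -
    have "ip H (P x) y = ip H (P x) (P y)" by (simp add: ipP P that)
    also have "\<dots> = star (ip H (P y) (P x))" by (simp add: H.ip_star PH that)
    also have "\<dots> = star (ip H (P y) x)" by (simp add: ipP P that)
    also have "\<dots> = ip H x (P y)" by (simp add: H.ip_star PH that)
    finally show ?thesis .
  qed
  have "blin H (submod H N) P"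
  proof (rule blinI[where B = 1], unfold submod_simps)
    fix x y a assume x: "x \<in> carrier H"
    show "P x \<in> N" by (rule P[OF x])
    show "P (act H x a) = act H (P x) a"
      using x by (intro uniq) (auto simp: H.act_mem Nm P H.ip_act_right Ns PH ipP)
    have "pos_elem (ip H (x - P x) (x - P x))" by (intro H.ip_pos H.diff_mem x PH)
    also have "ip H (x - P x) (x - P x) = ip H x x - ip H (P x) (P x)"
      using sym[OF x PH[OF x]] sym[OF x x] ipP[OF x P(1)[OF x]]
      by (simp add: H.ip_diff_left H.ip_diff_right x PH H.diff_mem)
    finally have "norm (ip H (P x) (P x)) \<le> norm (ip H x x)"
      using pos_elem_norm_mono[OF H.ip_pos[OF PH[OF x]]] by fastforce
    then show "hnorm H (P x) \<le> 1 * hnorm H x" by (simp add: hnorm_def)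
    assume y: "y \<in> carrier H"
    show "P (x + y) = P x + P y"
      using x y by (intro uniq) (auto simp: H.add_mem Nm P H.ip_add_right Ns PH ipP)
  qed
  moreover have "P x = x" if "x \<in> N" for x using that Ns by (intro uniq) auto
  moreover have "P x = 0" if "x \<in> orth_compl H N" for x
    using that Ns by (intro uniq) (auto simp: orth_compl_def Nm H.ip_zero_right)
  ultimately show thesis using that P(2) sym by blast
qed

text \<open>Let \<open>P\<close>, \<open>Q\<close> be the orthogonal projections onto \<open>N\<^sub>1'\<close>, \<open>N\<^sub>2\<close>, let \<open>S = \<iota>\<^sup>*\<close> and
  \<open>R = (S \<iota>)\<^sup>-\<^sup>1\<close>. For \<open>C = S P\<close> the map \<open>G = \<iota> R Q\<close> is a right inverse of \<open>C\<close> on \<open>N\<^sub>2\<close>, and the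
  following decompositions work:
  \<open>{(m, s). m \<in> M\<^sub>1, P s = G (S (P s))}\<close> and \<open>{(n, s). n \<in> N\<^sub>1, s \<in> N\<^sub>1', F n + S s = 0}\<close> of the domain,
  \<open>{(z, v). v - D (G z) \<in> M\<^sub>2'}\<close> and \<open>{0} \<times> N\<^sub>2'\<close> of the codomain.\<close>

lemma MPhi_minus_embedding:
  fixes H :: "('a::cstar_algebra, 'h::ab_group_add) hmodule"
    and K :: "('a, 'k::ab_group_add) hmodule"
  assumes "ip_module H" "ip_module K" "complete_hmodule H" "F \<in> Ba H H" "D \<in> Ba K K"
    and dF: "diagonal_wrt H F M1 N1 (orth_compl H N2) N2"
    and dD: "diagonal_wrt K D (orth_compl K N1') N1' M2' N2'"
    and isoF: "mod_iso (submod H M1) (submod H (orth_compl H N2)) F"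
    and isoD: "mod_iso (submod K (orth_compl K N1')) (submod K M2') D"
    and fg: "fin_gen (submod K N2')"
    and \<iota>: "\<iota> \<in> Ba (submod H N2) (submod K N1')"
    and iso\<iota>: "mod_iso (submod H N2) (submod K (\<iota> ` N2)) \<iota>"
  shows "\<exists>C \<in> Ba K H. upper_triangular F C D \<in> MPhi_minus (H \<oplus>\<^sub>H K)"
proof -
  interpret H: ip_module H by fact
  interpret K: ip_module K by fact
  interpret HK: ip_module "H \<oplus>\<^sub>H K" by (rule ip_module_hsum[OF assms(1,2)])
  note HKm = HK.ip_module_axioms
  have dsH: "direct_sum H M1 N1" "direct_sum H (orth_compl H N2) N2"
    and dsK: "direct_sum K (orth_compl K N1') N1'" "direct_sum K M2' N2'"
    and Fim: "\<And>x. x \<in> M1 \<Longrightarrow> F x \<in> orth_compl H N2" "\<And>x. x \<in> N1 \<Longrightarrow> F x \<in> N2"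
    and Dim: "\<And>x. x \<in> orth_compl K N1' \<Longrightarrow> D x \<in> M2'" "\<And>x. x \<in> N1' \<Longrightarrow> D x \<in> N2'"
    using dF dD by (auto simp: diagonal_wrt_def)
  have cl: "closed_submodule H M1" "closed_submodule H N1" "closed_submodule H N2"
    "closed_submodule H (orth_compl H N2)" "closed_submodule K N1'" "closed_submodule K M2'"
    "closed_submodule K N2'" "closed_submodule K (orth_compl K N1')"
    using dsH dsK by (auto simp: direct_sum_def)
  note sub = cl[THEN closed_submoduleD(1), THEN subsetD]
  interpret N2: ip_module "submod H N2" by (rule H.ip_module_submod[OF cl(3)])
  interpret N1': ip_module "submod K N1'" by (rule K.ip_module_submod[OF cl(5)])
  interpret N2': ip_module "submod K N2'" by (rule K.ip_module_submod[OF cl(7)])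
  have F: "blin H H F" and D: "blin K K D" using BaE assms(4,5) by blast+
  note Fl = blinD[OF F] and Dl = blinD[OF D]
  obtain P where P: "blin K (submod K N1') P" and P1: "\<And>x. x \<in> carrier K \<Longrightarrow> x - P x \<in> orth_compl K N1'"
    and P2: "\<And>x. x \<in> N1' \<Longrightarrow> P x = x" and P3: "\<And>x. x \<in> orth_compl K N1' \<Longrightarrow> P x = 0"
    and P4: "\<And>x y. x \<in> carrier K \<Longrightarrow> y \<in> carrier K \<Longrightarrow> ip K (P x) y = ip K x (P y)"
    using orth_projection[OF assms(2) dsK(1)] by metis
  obtain Q where Q: "blin H (submod H N2) Q" and Q1: "\<And>x. x \<in> carrier H \<Longrightarrow> x - Q x \<in> orth_compl H N2"
    and Q2: "\<And>x. x \<in> N2 \<Longrightarrow> Q x = x" and Q3: "\<And>x. x \<in> orth_compl H N2 \<Longrightarrow> Q x = 0"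
    and Q4: "\<And>x y. x \<in> carrier H \<Longrightarrow> y \<in> carrier H \<Longrightarrow> ip H (Q x) y = ip H x (Q y)"
    using orth_projection[OF assms(1) dsH(2)] by metis
  obtain S where \<iota>l: "blin (submod H N2) (submod K N1') \<iota>" and S0: "\<And>y. y \<in> N1' \<Longrightarrow> S y \<in> N2"
    and adj: "\<And>x y. x \<in> N2 \<Longrightarrow> y \<in> N1' \<Longrightarrow> ip K (\<iota> x) y = ip H x (S y)"
    using BaE[OF \<iota>] by auto
  have S: "blin (submod K N1') (submod H N2) S"
    using S0 adj by (intro blin_adjoint[OF N2.ip_module_axioms N1'.ip_module_axioms \<iota>l]) auto
  obtain j where j: "blin (submod H N2) (submod K (\<iota> ` N2)) \<iota>"
    "blin (submod K (\<iota> ` N2)) (submod H N2) j" "\<And>x. x \<in> N2 \<Longrightarrow> j (\<iota> x) = x"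
    "\<And>y. y \<in> \<iota> ` N2 \<Longrightarrow> \<iota> (j y) = y"
    by (rule mod_isoE[OF iso\<iota> N2.ip_module_axioms, unfolded submod_simps]) (rule that)
  obtain c where c: "c \<ge> 1" "\<And>y. y \<in> \<iota> ` N2 \<Longrightarrow> hnorm H (j y) \<le> c * hnorm K y"
    using blin_bound[OF j(2), unfolded submod_simps] by blast
  have below: "hnorm H x \<le> c * hnorm K (\<iota> x)" if "x \<in> N2" for x
    using c(2)[of "\<iota> x"] j(3) that by simp
  obtain R where R: "blin (submod H N2) (submod H N2) R" and SR: "\<And>y. y \<in> N2 \<Longrightarrow> S (\<iota> (R y)) = y"
    using adjoint_mult_self_inverse[OF N2.ip_module_axioms N1'.ip_module_axioms
        complete_hmodule_submod[OF assms(3) cl(3)] \<iota>l S _ _ c(1)] adj below by auto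
  obtain JF where JF: "blin (submod H (orth_compl H N2)) (submod H M1) JF"
    "\<And>x. x \<in> M1 \<Longrightarrow> JF (F x) = x" "\<And>y. y \<in> orth_compl H N2 \<Longrightarrow> F (JF y) = y"
    by (rule mod_isoE[OF isoF H.ip_module_submod[OF cl(1)], unfolded submod_simps]) (rule that)
  obtain JD where JD: "blin (submod K M2') (submod K (orth_compl K N1')) JD"
    "\<And>x. x \<in> orth_compl K N1' \<Longrightarrow> JD (D x) = x" "\<And>y. y \<in> M2' \<Longrightarrow> D (JD y) = y"
    by (rule mod_isoE[OF isoD K.ip_module_submod[OF cl(8)], unfolded submod_simps]) (rule that)
  define C where "C x = S (P x)" for x
  define G where "G z = \<iota> (R (Q z))" for z
  have C: "blin K (submod H N2) C" unfolding C_def by (rule blin_compose[OF P S])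
  have CH: "blin K H C" by (rule blin_superset[OF C closed_submoduleD(1)[OF cl(3)]])
  have G: "blin H (submod K N1') G"
    unfolding G_def by (rule blin_compose[OF blin_compose[OF Q R] \<iota>l])
  have GK: "blin H K G" by (rule blin_superset[OF G closed_submoduleD(1)[OF cl(5)]])
  have PK: "blin K K P" by (rule blin_superset[OF P closed_submoduleD(1)[OF cl(5)]])
  have QH: "blin H H Q" by (rule blin_superset[OF Q closed_submoduleD(1)[OF cl(3)]])
  note Cm = blinD(1)[OF C, unfolded submod_simps] and Gm = blinD(1)[OF G, unfolded submod_simps]
    and Pm = blinD(1)[OF P, unfolded submod_simps] and Qm = blinD(1)[OF Q, unfolded submod_simps]
  note Cd = blin_diff[OF assms(2) CH] and Gd = blin_diff[OF assms(1) GK]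
    and Pd = blin_diff[OF assms(2) PK] and Dd = blin_diff[OF assms(2) D]
    and Qa = blinD(2)[OF QH]
  note z = blin_zero[OF assms(1) F] blin_zero[OF assms(2) D] blin_zero[OF assms(2) CH]
    blin_zero[OF assms(1) GK] blin_zero[OF assms(2) PK]
  \<comment> \<open>Consequently G C is idempotent; it is the orthogonal projection onto
    \<open>\<iota>\<close> followed by no further map, with image \<open>\<iota>\<close> of
    N2.\<close>
  have CG: "C (G x) = Q x" if "x \<in> carrier H" for x
    unfolding C_def G_def using that Gm[OF that] Qm by (simp add: P2 SR G_def)
  have GQ: "G x = G y" if "Q x = Q y" for x y using that by (simp add: G_def)
  have CP: "C (P x) = C x" if "x \<in> carrier K" for x using Pm[OF that] by (simp add: C_def P2)
  have CBa: "C \<in> Ba K H"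
  \<comment> \<open>The adjoint of S is \<open>\<iota>\<close>, which lives on N2 only; so a vector
    of H is first projected by Q. Its image already lies in N1', where P is the identity.\<close>
  proof (rule BaI[OF CH, where S = "\<lambda>y. \<iota> (Q y)"])
    fix x y assume x: "x \<in> carrier K" and y: "y \<in> carrier H"
    have \<iota>m: "\<iota> (Q y) \<in> N1'" using blinD(1)[OF \<iota>l] Qm[OF y] by simp
    have "ip H (C x) y = ip H (C x) (Q y)" using Q4[of "C x" y] Q2 Cm[OF x] sub(3) y by simp
    also have "\<dots> = star (ip H (Q y) (S (P x)))"
      using Cm[OF x] Qm[OF y] sub(3) by (simp add: H.ip_star C_def)
    also have "\<dots> = star (ip K (\<iota> (Q y)) (P x))" using Pm[OF x] Qm[OF y] by (simp add: adj)
    also have "\<dots> = ip K (P x) (\<iota> (Q y))" using \<iota>m Pm[OF x] sub(5) by (simp add: K.ip_star)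
    also have "\<dots> = ip K x (\<iota> (Q y))" using P4[OF x, of "\<iota> (Q y)"] P2[OF \<iota>m] \<iota>m sub(5) by simp
    finally show "ip H (C x) y = ip K x (\<iota> (Q y))" .
  qed (use sub(5) blinD(1)[OF \<iota>l] Qm in auto)
  let ?T = "upper_triangular F C D"
  have TBa: "?T \<in> Ba (H \<oplus>\<^sub>H K) (H \<oplus>\<^sub>H K)" by (intro upper_triangular_Ba assms CBa)
  have T: "blin (H \<oplus>\<^sub>H K) (H \<oplus>\<^sub>H K) ?T" using BaE[OF TBa] by blast
  \<comment> \<open>The condition says that the N1'-part of s lies in the image of
    \<open>\<iota>\<close>: this is the product of M1 with the sum of that image and the complement
    of N1'. The form of a kernel gives closedness.\<close>
  define Md where "Md = (M1 \<times> carrier K) \<inter> {p \<in> carrier (H \<oplus>\<^sub>H K). P (snd p) - G (C (snd p)) \<in> {0}}"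
  \<comment> \<open>The first row vanishes here, so the image under the matrix is (0, D s) with D s
    in N2'.\<close>
  define Nd where "Nd = (N1 \<times> N1') \<inter> {p \<in> carrier (H \<oplus>\<^sub>H K). F (fst p) + C (snd p) \<in> {0}}"
  \<comment> \<open>The shift by D (G z) absorbs the part D (P s) in N2' of the second row, which
    would otherwise leave M2'.\<close>
  define Mc where "Mc = {p \<in> carrier (H \<oplus>\<^sub>H K). snd p - D (G (fst p)) \<in> M2'}"
  define Nc where "Nc = {0::'h} \<times> N2'"
  note bl_fst = blin_compose[OF blin_fst[OF assms(1,2)]] and bl_snd = blin_compose[OF blin_snd[OF assms(1,2)]]
  have clMd: "closed_submodule (H \<oplus>\<^sub>H K) Md" unfolding Md_def
    by (intro closed_submodule_Int closed_submodule_Times cl K.closed_submodule_carrier assms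
        closed_submodule_vimage[OF HKm assms(2)] K.closed_submodule_zero blin_diff_fun
        bl_snd[OF PK] bl_snd[OF blin_compose[OF CH GK]])
  have clNd: "closed_submodule (H \<oplus>\<^sub>H K) Nd" unfolding Nd_def
    by (intro closed_submodule_Int closed_submodule_Times cl assms
        closed_submodule_vimage[OF HKm assms(1)] H.closed_submodule_zero blin_add
        bl_snd[OF CH] bl_fst[OF F])
  have clMc: "closed_submodule (H \<oplus>\<^sub>H K) Mc" unfolding Mc_def
    by (intro closed_submodule_vimage[OF HKm assms(2)] cl blin_diff_fun assms
        blin_snd bl_fst[OF blin_compose[OF GK D]])
  have clNc: "closed_submodule (H \<oplus>\<^sub>H K) Nc" unfolding Nc_def
    by (intro closed_submodule_Times assms H.closed_submodule_zero cl)
  have Md_iff: "(m, s) \<in> Md \<longleftrightarrow> m \<in> M1 \<and> s \<in> carrier K \<and> P s = G (C s)" for m s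
    using sub(1) by (auto simp: Md_def)
  have Nd_iff: "(n, s) \<in> Nd \<longleftrightarrow> n \<in> N1 \<and> s \<in> N1' \<and> F n + C s = 0" for n s
    using sub(2,5) by (auto simp: Nd_def)
  have Mc_iff: "(y, v) \<in> Mc \<longleftrightarrow> y \<in> carrier H \<and> v \<in> carrier K \<and> v - D (G y) \<in> M2'" for y v
    by (auto simp: Mc_def)
  have dom: "direct_sum (H \<oplus>\<^sub>H K) Md Nd"
    unfolding direct_sum_def
  proof (intro conjI clMd clNd)
    have "\<exists>m\<in>Md. \<exists>n\<in>Nd. (x, y) = m + n" if x: "x \<in> carrier H" and y: "y \<in> carrier K" for x y
    proof -
      obtain m n where mn: "x = m + n" "m \<in> M1" "n \<in> N1" using dsH(1) x by (auto simp: direct_sum_def)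
      have Fn: "F n \<in> N2" by (rule Fim(2)[OF mn(3)])
      \<comment> \<open>The part s must satisfy C s = - F n, so C has to take the value w on y - s;
        and G w is the element of the image of \<open>\<iota>\<close> on which it does.\<close>
      define w where "w = C y + F n"
      have w: "w \<in> N2" using N2.add_mem Cm[OF y] Fn by (simp add: w_def)
      define s where "s = P y - G w"
      have Gw: "G w \<in> N1'" by (rule Gm[OF sub(3)[OF w]])
      have s: "s \<in> N1'" using N1'.diff_mem Pm[OF y] Gw by (simp add: s_def)
      have Cs: "C s = - F n"
        using Cd[of "P y" "G w"] Pm[OF y] Gw sub(5) CP[OF y] CG[OF sub(3)[OF w]] Q2[OF w]
        by (simp add: s_def w_def)
      then have 1: "(n, s) \<in> Nd" using mn(3) s by (simp add: Nd_iff)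
      have "P (y - s) = G w" using Pd[OF y sub(5)[OF s]] P2[OF s] by (simp add: s_def)
      moreover have "C (y - s) = w" using Cd[OF y sub(5)[OF s]] Cs by (simp add: w_def)
      ultimately have 2: "(m, y - s) \<in> Md"
        using mn(2) K.diff_mem[OF y sub(5)[OF s]] by (simp add: Md_iff)
      show ?thesis by (rule bexI[OF bexI[OF _ 1] 2]) (simp add: mn)
    qed
    then have "carrier (H \<oplus>\<^sub>H K) \<subseteq> {m + n |m n. m \<in> Md \<and> n \<in> Nd}" by fastforce
    moreover have "m + n \<in> carrier (H \<oplus>\<^sub>H K)" if "m \<in> Md" "n \<in> Nd" for m n
      using HK.add_mem closed_submoduleD(1)[OF clMd] closed_submoduleD(1)[OF clNd] that by blast
    ultimately show "carrier (H \<oplus>\<^sub>H K) = {m + n |m n. m \<in> Md \<and> n \<in> Nd}" by blast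
    have "p = 0" if p: "p \<in> Md" "p \<in> Nd" for p
    proof -
      obtain m s where ms: "p = (m, s)" by (cases p)
      have "m \<in> M1 \<inter> N1" using p by (simp add: ms Md_iff Nd_iff)
      then have m: "m = 0" using dsH(1) unfolding direct_sum_def by blast
      then have "C s = 0" "s = G (C s)" using p P2[of s] z by (simp_all add: ms Md_iff Nd_iff)
      then have "s = 0" using z by metis
      then show ?thesis using m ms by (simp add: zero_prod_def)
    qed
    then show "Md \<inter> Nd = {0}"
      using closed_submoduleD(2)[OF clMd] closed_submoduleD(2)[OF clNd] by blast
  qed
  have cod: "direct_sum (H \<oplus>\<^sub>H K) Mc Nc"
    unfolding direct_sum_def
  proof (intro conjI clMc clNc)
    have "\<exists>m\<in>Mc. \<exists>n\<in>Nc. (x, y) = m + n" if x: "x \<in> carrier H" and y: "y \<in> carrier K" for x y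
    proof -
      have g: "D (G x) \<in> carrier K" by (intro Dl sub(5)[OF Gm] x)
      have "y - D (G x) \<in> carrier K" by (rule K.diff_mem[OF y g])
      then obtain w n where wn: "y - D (G x) = w + n" "w \<in> M2'" "n \<in> N2'"
        using dsK(2) by (auto simp: direct_sum_def)
      have "y - n - D (G x) = w" using wn(1) by (simp add: algebra_simps)
      then have 1: "(x, y - n) \<in> Mc" using x y sub(7) wn by (simp add: Mc_iff K.diff_mem)
      have 2: "(0, n) \<in> Nc" using wn by (simp add: Nc_def)
      show ?thesis by (rule bexI[OF bexI[OF _ 2] 1]) simp
    qed
    then have "carrier (H \<oplus>\<^sub>H K) \<subseteq> {m + n |m n. m \<in> Mc \<and> n \<in> Nc}" by fastforce
    moreover have "m + n \<in> carrier (H \<oplus>\<^sub>H K)" if "m \<in> Mc" "n \<in> Nc" for m n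
      using HK.add_mem closed_submoduleD(1)[OF clMc] closed_submoduleD(1)[OF clNc] that by blast
    ultimately show "carrier (H \<oplus>\<^sub>H K) = {m + n |m n. m \<in> Mc \<and> n \<in> Nc}" by blast
    have "M2' \<inter> N2' = {0}" using dsK(2) by (simp add: direct_sum_def)
    then have "p = 0" if "p \<in> Mc" "p \<in> Nc" for p
      using that z by (cases p) (auto simp: Mc_iff Nc_def zero_prod_def)
    then show "Mc \<inter> Nc = {0}"
      using closed_submoduleD(2)[OF clMc] closed_submoduleD(2)[OF clNc] by blast
  qed
  have onMd: "Q (F m + C s) = C s" "G (F m + C s) = P s" "D s - D (P s) \<in> M2'"
    "F m + C s \<in> carrier H" if ms: "(m, s) \<in> Md" for m s
  proof -
    have m: "m \<in> M1" and s: "s \<in> carrier K" and Ps: "P s = G (C s)" using ms by (auto simp: Md_iff)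
    have Fm: "F m \<in> carrier H" by (intro Fl sub(1)[OF m])
    have Cs: "C s \<in> carrier H" by (rule sub(3)[OF Cm[OF s]])
    show 1: "Q (F m + C s) = C s" using Qa[OF Fm Cs] Q3[OF Fim(1)[OF m]] Q2[OF Cm[OF s]] by simp
    then show "G (F m + C s) = P s" using GQ[of "F m + C s" "C s"] Q2[OF Cm[OF s]] Ps by simp
    have "D (s - P s) \<in> M2'" by (intro Dim P1 s)
    then show "D s - D (P s) \<in> M2'" using Dd[OF s sub(5)[OF Pm[OF s]]] by simp
    show "F m + C s \<in> carrier H" by (rule H.add_mem[OF Fm Cs])
  qed
  have TMd: "?T ` Md \<subseteq> Mc"
  proof (rule image_subsetI)
    fix p assume p: "p \<in> Md"
    obtain m s where ms: "p = (m, s)" by (cases p)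
    have Md: "(m, s) \<in> Md" using p by (simp add: ms)
    then have "D s \<in> carrier K" by (simp add: Md_iff Dl)
    then show "?T p \<in> Mc"
      unfolding ms upper_triangular_apply Mc_iff onMd(2)[OF Md] using onMd(3,4)[OF Md] by blast
  qed
  have TNd: "?T ` Nd \<subseteq> Nc" by (auto simp: Nd_iff Nc_def Dim)
  have diag: "diagonal_wrt (H \<oplus>\<^sub>H K) ?T Md Nd Mc Nc"
    unfolding diagonal_wrt_def using dom cod TMd TNd by blast
  \<comment> \<open>For (z, v) in the image, Q z is C s, so G z recovers P s. Then z - Q z = F m,
    and v - D (G z) = D (s - P s); both are inverted by the given isomorphisms.\<close>
  define J where "J p = (JF (fst p - Q (fst p)), JD (snd p - D (G (fst p))) + G (fst p))" for p
  have JFm: "JF y \<in> M1" if "y \<in> orth_compl H N2" for y using blinD(1)[OF JF(1)] that by simp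
  have JDm: "JD y \<in> orth_compl K N1'" if "y \<in> M2'" for y using blinD(1)[OF JD(1)] that by simp
  have JMc: "J p \<in> Md" "?T (J p) = p" if pMc: "p \<in> Mc" for p
  proof -
    obtain y v where p: "p = (y, v)" by (cases p)
    have y: "y \<in> carrier H" and v: "v \<in> carrier K" and w: "v - D (G y) \<in> M2'"
      using pMc by (auto simp: p Mc_iff)
    define u where "u = JD (v - D (G y))"
    have u: "u \<in> orth_compl K N1'" "u \<in> carrier K" "D u = v - D (G y)"
      using JDm[OF w] JD(3)[OF w] sub(8) by (auto simp: u_def)
    have Gy: "G y \<in> N1'" "G y \<in> carrier K" using Gm[OF y] sub(5) by auto
    have uG: "u + G y \<in> carrier K" by (rule K.add_mem[OF u(2) Gy(2)])
    have Pu: "P (u + G y) = G y" using blinD(2)[OF PK u(2) Gy(2)] P3[OF u(1)] P2[OF Gy(1)] by simp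
    then have Cu: "C (u + G y) = Q y" using CP[OF uG] CG[OF y] by simp
    have "Q (Q y) = Q y" by (rule Q2[OF Qm[OF y]])
    then have "G (Q y) = G y" by (rule GQ)
    then show "J p \<in> Md"
      using JFm[OF Q1[OF y]] uG Pu Cu by (simp add: J_def p Md_iff u_def)
    show "?T (J p) = p"
      using JF(3)[OF Q1[OF y]] Cu Dl(2)[OF u(2) Gy(2)] u(3) by (simp add: J_def p u_def)
  qed
  have JT: "J (?T p) = p" if "p \<in> Md" for p
  proof -
    obtain m s where p: "p = (m, s)" by (cases p)
    have ms: "m \<in> M1" "s \<in> carrier K" and pMd: "(m, s) \<in> Md" using that by (auto simp: p Md_iff)
    have "D s - D (P s) = D (s - P s)" using Dd[OF ms(2) sub(5)[OF Pm[OF ms(2)]]] by simp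
    then have "JD (D s - D (P s)) = s - P s" using JD(2)[OF P1[OF ms(2)]] by simp
    then show ?thesis by (simp add: p J_def onMd[OF pMd] JF(2)[OF ms(1)])
  qed
  let ?Mc = "submod (H \<oplus>\<^sub>H K) Mc"
  have idMc: "blin ?Mc (H \<oplus>\<^sub>H K) (\<lambda>p. p)"
    using closed_submoduleD(1)[OF clMc] by (intro blinI[where B = 1]) auto
  have fstMc: "blin ?Mc H (\<lambda>p. U (fst p))" if "blin H H U" for U
    by (rule blin_compose[OF idMc bl_fst[OF that]])
  have J1: "blin ?Mc (submod H (orth_compl H N2)) (\<lambda>p. fst p - Q (fst p))"
  proof -
    have "blin (H \<oplus>\<^sub>H K) H (\<lambda>p. fst p - Q (fst p))"
      by (intro blin_diff_fun assms blin_fst bl_fst[OF QH])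
    then show ?thesis
      using closed_submoduleD(1)[OF clMc] Q1 by (intro blin_subset) auto
  qed
  have J2: "blin ?Mc (submod K M2') (\<lambda>p. snd p - D (G (fst p)))"
  proof -
    have "blin (H \<oplus>\<^sub>H K) K (\<lambda>p. snd p - D (G (fst p)))"
      by (intro blin_diff_fun assms blin_snd bl_fst[OF blin_compose[OF GK D]])
    then show ?thesis
      using closed_submoduleD(1)[OF clMc] by (intro blin_subset) (auto simp: Mc_def)
  qed
  have J3: "blin ?Mc H (\<lambda>p. JF (fst p - Q (fst p)))"
    by (rule blin_superset[OF blin_compose[OF J1 JF(1)] closed_submoduleD(1)[OF cl(1)]])
  have J4: "blin ?Mc K (\<lambda>p. JD (snd p - D (G (fst p))))"
    by (rule blin_superset[OF blin_compose[OF J2 JD(1)] closed_submoduleD(1)[OF cl(8)]])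
  have "blin ?Mc (H \<oplus>\<^sub>H K) J"
    unfolding J_def
    by (intro blin_Pair assms J3 blin_add J4 blin_compose[OF idMc bl_fst[OF GK]])
  \<comment> \<open>\<open>blin_subset\<close> restricts domain and codomain together; restricting
    the domain to Mc once more leaves it unchanged.\<close>
  then have "blin (submod ?Mc Mc) (submod (H \<oplus>\<^sub>H K) Md) J"
    using JMc(1) by (intro blin_subset) auto
  then have J: "blin ?Mc (submod (H \<oplus>\<^sub>H K) Md) J" by (simp add: submod_def)
  have "mod_iso (submod (H \<oplus>\<^sub>H K) Md) ?Mc ?T"
    using blin_subset[OF T closed_submoduleD(1)[OF clMd] TMd] J
    by (rule mod_isoI) (simp_all add: JT JMc)
  moreover have "fin_gen (submod (H \<oplus>\<^sub>H K) Nc)"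
    unfolding Nc_def
  proof (intro fin_gen_hsum assms H.closed_submodule_zero cl fg)
    show "fin_gen (submod H {0})" unfolding fin_gen_def by (intro exI[of _ "{}"]) simp
  qed
  ultimately have "?T \<in> MPhi_minus (H \<oplus>\<^sub>H K)"
    unfolding MPhi_minus_def using TBa diag by blast
  then show ?thesis using CBa by blast
qed

theorem theorem3p13:
  fixes F D :: "(nat \<Rightarrow> 'a::cstar_algebra) \<Rightarrow> (nat \<Rightarrow> 'a)"
  assumes "F \<in> Ba ell2 ell2" and "D \<in> Ba ell2 ell2"
    and "D \<in> MPhi_minus ell2"
    and "F \<in> MPhi_minus ell2 \<or>
      (\<exists>M1 N1 N2 N1' M2' N2'.
         diagonal_wrt ell2 F M1 N1 (orth_compl ell2 N2) N2 \<and>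
         diagonal_wrt ell2 D (orth_compl ell2 N1') N1' M2' N2' \<and>
         mod_iso (submod ell2 M1) (submod ell2 (orth_compl ell2 N2)) F \<and>
         mod_iso (submod ell2 (orth_compl ell2 N1')) (submod ell2 M2') D \<and>
         fin_gen (submod ell2 N2') \<and>
         (\<exists>\<iota> \<in> Ba (submod ell2 N2) (submod ell2 N1').
            mod_iso (submod ell2 N2) (submod ell2 (\<iota> ` N2)) \<iota>))"
  shows "\<exists>C \<in> Ba ell2 ell2. upper_triangular F C D \<in> MPhi_minus (ell2 \<oplus>\<^sub>H ell2)"
  using assms(4)
proof
  assume "F \<in> MPhi_minus ell2"
  then show ?thesis
    using MPhi_minus_diagonal[OF ip_module_ell2 ip_module_ell2 _ assms(3)]
      zero_fun_Ba[OF ip_module_ell2 ip_module_ell2] by blast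
next
  assume "\<exists>M1 N1 N2 N1' M2' N2'.
    diagonal_wrt ell2 F M1 N1 (orth_compl ell2 N2) N2 \<and>
    diagonal_wrt ell2 D (orth_compl ell2 N1') N1' M2' N2' \<and>
    mod_iso (submod ell2 M1) (submod ell2 (orth_compl ell2 N2)) F \<and>
    mod_iso (submod ell2 (orth_compl ell2 N1')) (submod ell2 M2') D \<and>
    fin_gen (submod ell2 N2') \<and>
    (\<exists>\<iota> \<in> Ba (submod ell2 N2) (submod ell2 N1').
       mod_iso (submod ell2 N2) (submod ell2 (\<iota> ` N2)) \<iota>)"
  then show ?thesis
    using MPhi_minus_embedding[OF ip_module_ell2 ip_module_ell2 complete_ell2 assms(1,2)] by blast
qed

end
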